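(* There exists a positive constant $C$ depending only on $m$ and $n$ such that for all $\lambda>0$, $$\big|\{x\in\mathbf R^n:\ \mathcal M_{\mathcal R}(\vec f\,)(x)>\lambda^m\}\big|\le C\Big\{\prod_{i=1}^m\int_{\mathbf R^n}\Phi_n^{(m)}\Big(\frac{|f_i(x)|}{\lambda}\Big)\,dx\Big\}^{1/m}$$ for all functions $f_i$ on $\mathbf R^n$, $i=1,\dots,m$, where $\vec f=(f_1,\dots,f_m)$. Furthermore, this is sharp in the sense that one cannot replace $\Phi_n^{(m)}$ by $\Phi_n^{(k)}$ for $k\le m-1$.
   Context: The multilinear strong maximal function of a vector $\vec f=(f_1,\dots,f_m)$ of locally integrable functions on $\mathbf R^n$ is $$\mathcal M_{\mathcal R}(\vec f\,)(x)=\sup_{R\ni x}\ \prod_{i=1}^m\Big(\frac1{|R|}\int_R|f_i(y)|\,dy\Big),\qquad x\in\mathbf R^n,$$ where the supremum is over all rectangles $R\subset\mathbf R^n$ with sides parallel to the coordinate axes containing $x$. For $t>0$, $\Phi_n(t)=t\,(1+(\log^+t)^{n-1})\approx t(\log(e+t))^{n-1}$, with $\log^+t=\max(\log t,0)$, and $\Phi_n(0)=0$; for $k\in\mathbb N$, $\Phi_n^{(k)}=\Phi_n\circ\cdots\circ\Phi_n$ ($k$ times). $|E|$ denotes Lebesgue measure.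
   Formalization: The sharpness claim is stated only for n ≥ 2: for n = 1 one has Φ_1(t) = 2t, so all Φ_1^{(k)} are constant multiples of each other, Φ_1^{(m)} can be replaced by Φ_1^{(k)}, and sharpness fails. *)

theory Defs
  imports "HOL-Analysis.Analysis"
begin

definition locally_integrable :: "(real^'n \<Rightarrow> complex) \<Rightarrow> bool" where
  "locally_integrable f \<longleftrightarrow> (\<forall>K. compact K \<longrightarrow> set_integrable lebesgue K f)"

(* Rectangles are taken open (and non-degenerate).  For locally integrable functions the
   supremum below is the same for closed or half-open rectangles: enlarge slightly. *)
definition rectangles :: "(real^'n) set set" where
  "rectangles = {box a b | a b. \<forall>i. a $ i < b $ i}"

definition strong_maximal :: "nat \<Rightarrow> (nat \<Rightarrow> real^'n \<Rightarrow> complex) \<Rightarrow> real^'n \<Rightarrow> ennreal" where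
  "strong_maximal m f x =
     (SUP R \<in> {R \<in> rectangles. x \<in> R}.
        \<Prod>i\<in>{1..m}. (\<integral>\<^sup>+y\<in>R. ennreal (cmod (f i y)) \<partial>lebesgue) / emeasure lebesgue R)"

definition log_plus :: "real \<Rightarrow> real" where
  "log_plus t = max (ln t) 0"

(* Only used for t \<ge> 0; the factor t gives Phi n 0 = 0. *)
definition Phi :: "nat \<Rightarrow> real \<Rightarrow> real" where
  "Phi n t = t * (1 + log_plus t ^ (n - 1))"

(* The power 1/m on [0,\<infinity>]. *)
definition ennroot :: "nat \<Rightarrow> ennreal \<Rightarrow> ennreal" where
  "ennroot m x = (if x = top then top else ennreal (root m (enn2real x)))"

(* The product of integrals uses the convention 0 * \<infinity> = 0.  That case arises only if some
   f i vanishes almost everywhere, and then the left-hand side is 0 as well. *)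
definition distributional_estimate ::
    "real \<Rightarrow> nat \<Rightarrow> nat \<Rightarrow> real \<Rightarrow> (nat \<Rightarrow> real^'n \<Rightarrow> complex) \<Rightarrow> bool" where
  "distributional_estimate C m k s f \<longleftrightarrow>
     emeasure lebesgue {x. strong_maximal m f x > ennreal (s ^ m)}
       \<le> ennreal C * ennroot m (\<Prod>i\<in>{1..m}.
            \<integral>\<^sup>+x. ennreal ((Phi CARD('n) ^^ k) (cmod (f i x) / s)) \<partial>lebesgue)"

end

theory Submission
  imports Defs
begin

text \<open>
  Upper bound.  Averaging over a box is averaging over its sides one after another, and each
  one-dimensional maximal operator turns \<open>L (log L) ^ k\<close> into \<open>L (log L) ^ (k + 1)\<close>; this gives
  the linear weak-type bound \<open>|{M g > 1}| \<le> C \<integral> H(g)\<close>, where \<open>H(u)\<close> is comparable to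
  \<open>u (1 + log\<^sup>+ u) ^ (n - 1)\<close> and, crucially, vanishes for small \<open>u\<close>.  If \<open>\<Prod>i. t i \<le> 1\<close>, the level
  set of the multilinear operator is covered by the sets where \<open>M (f i / s) > t i\<close> (up to a
  constant).  For \<open>\<alpha>\<close> a large multiple of the right-hand side of the estimate, such \<open>t i\<close> exist
  with \<open>\<integral> H(f i / (s t i)) \<le> \<alpha>\<close> for all \<open>i\<close>: otherwise there would be \<open>t i\<close> of product at least 1
  violating all these bounds, but \<open>H(u / t) \<le> C \<kappa>(t) Phi^m(u)\<close>, where \<open>\<kappa>(t)\<close> is
  \<open>1 / (t (1 + log t) ^ ((m - 1) (n - 1)))\<close> for \<open>t \<ge> 1\<close> and \<open>(1 + log (1/t)) ^ (n - 1) / t\<close> for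
  \<open>t < 1\<close>, and \<open>\<Prod>i. \<kappa>(t i)\<close> is bounded: the logarithm of the largest \<open>t i\<close> compensates the at most
  \<open>m - 1\<close> logarithms that come from the small ones.

  Sharpness.  For \<open>s = 1\<close>, \<open>f 1\<close> equal to \<open>2 A ^ m\<close> on the unit cube and the other functions equal
  to 1 there, the level set has measure at least a multiple of \<open>A (log A) ^ (n - 1)\<close>, whereas the
  right-hand side with \<open>Phi^k\<close> is at most a multiple of \<open>A (log A) ^ (k (n - 1) / m)\<close>.
\<close>

section \<open>The one-dimensional maximal function\<close>

text \<open>Greedy selection: a longest interval \<open>J0\<close> is kept, every interval meeting
  it lies in the concentric interval of three times its length, and the intervals disjoint from
  \<open>J0\<close> are left to the induction.\<close>

lemma interval_vitali:
  fixes F :: "real set set"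
  assumes "finite F" "\<And>J. J \<in> F \<Longrightarrow> \<exists>a b. a < b \<and> J = {a<..<b}"
  shows "\<exists>D\<subseteq>F. disjoint D \<and> emeasure lborel (\<Union>F) \<le> 3 * (\<Sum>J\<in>D. emeasure lborel J)"
  using assms
proof (induction F rule: finite_psubset_induct)
  case (psubset F)
  show ?case
  proof (cases "F = {}")
    case True
    then show ?thesis by (intro exI[of _ "{}"]) (auto simp: disjoint_def)
  next
    case False
    have "Max (measure lborel ` F) \<in> measure lborel ` F"
      using False psubset.hyps by (intro Max_in) auto
    then obtain J0 where J0: "J0 \<in> F" "measure lborel J0 = Max (measure lborel ` F)" by auto
    have mx: "measure lborel J \<le> measure lborel J0" if "J \<in> F" for J
      using J0(2) psubset.hyps that by simp
    obtain a b where ab: "a < b" "J0 = {a<..<b}" using psubset.prems J0(1) by blast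
    define F' where "F' = {J\<in>F. J \<inter> J0 = {}}"
    have "J0 \<notin> F'" using ab by (auto simp: F'_def)
    then have "F' \<subset> F" using J0(1) by (auto simp: F'_def)
    then obtain D where D: "D \<subseteq> F'" "disjoint D"
        "emeasure lborel (\<Union>F') \<le> 3 * (\<Sum>J\<in>D. emeasure lborel J)"
      using psubset.IH[of F'] psubset.prems by (auto simp: F'_def)
    have fD: "finite D" using D(1) psubset.hyps F'_def finite_subset by fastforce
    have sub: "\<Union>F \<subseteq> \<Union>F' \<union> {2*a-b<..<2*b-a}"
    proof
      fix x assume "x \<in> \<Union>F"
      then obtain J where J: "J \<in> F" "x \<in> J" by auto
      show "x \<in> \<Union>F' \<union> {2*a-b<..<2*b-a}"
      proof (cases "J \<in> F'")
        case False
        obtain c d where cd: "c < d" "J = {c<..<d}" using psubset.prems J(1) by blast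
        have "d - c \<le> b - a" using mx[OF J(1)] ab cd by simp
        moreover obtain y where "y \<in> J" "y \<in> J0" using False J(1) by (auto simp: F'_def)
        ultimately show ?thesis using J(2) cd ab by auto
      qed (use J in auto)
    qed
    have openF: "open (\<Union>F)" "open (\<Union>F')"
      using psubset.prems by (auto simp: F'_def intro!: open_Union) (metis open_greaterThanLessThan)+
    have "emeasure lborel (\<Union>F) \<le> emeasure lborel (\<Union>F' \<union> {2*a-b<..<2*b-a})"
      using sub openF by (intro emeasure_mono) auto
    also have "\<dots> \<le> emeasure lborel (\<Union>F') + emeasure lborel {2*a-b<..<2*b-a}"
      using openF by (intro emeasure_subadditive) auto
    also have "emeasure lborel {2*a-b<..<2*b-a} = 3 * emeasure lborel J0"
      using ab ennreal_mult[of 3 "b - a"] by (simp add: algebra_simps)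
    also have "emeasure lborel (\<Union>F') + 3 * emeasure lborel J0 \<le> 3 * (\<Sum>J\<in>insert J0 D. emeasure lborel J)"
      using D \<open>J0 \<notin> F'\<close> fD by (subst sum.insert) (auto simp: distrib_left add.commute)
    finally have "emeasure lborel (\<Union>F) \<le> 3 * (\<Sum>J\<in>insert J0 D. emeasure lborel J)" .
    moreover have "disjoint (insert J0 D)"
      using D(1,2) by (auto simp: disjoint_def F'_def)
    moreover have "insert J0 D \<subseteq> F" using D(1) J0(1) by (auto simp: F'_def)
    ultimately show ?thesis by blast
  qed
qed

definition average :: "'a measure \<Rightarrow> 'a set \<Rightarrow> ('a \<Rightarrow> ennreal) \<Rightarrow> ennreal" where
  "average M R f = (\<integral>\<^sup>+y\<in>R. f y \<partial>M) / emeasure M R"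

text \<open>The indicator lets the supremum run over a fixed family instead of one depending on
  \<open>x\<close>; for countable families measurability is then immediate. Measure and family are
  parameters because the operator is used on the line, on finite products and on
  \<open>real^'n\<close>.\<close>

definition maximal :: "'a measure \<Rightarrow> 'a set set \<Rightarrow> ('a \<Rightarrow> ennreal) \<Rightarrow> 'a \<Rightarrow> ennreal" where
  "maximal M \<B> f x = (SUP R\<in>\<B>. average M R f * indicator R x)"

text \<open>Rational endpoints make the family countable. Arbitrary boxes are recovered at the end
  by \<open>rat_box_enlargement\<close>.\<close>

definition rat_intervals :: "real set set" where
  "rat_intervals = {{a<..<b} | a b. a \<in> \<rat> \<and> b \<in> \<rat> \<and> a < b}"

lemma countable_rat_intervals: "countable rat_intervals"
proof -
  have "rat_intervals \<subseteq> (\<lambda>(a,b). {a<..<b}) ` (\<rat> \<times> \<rat>)"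
    by (auto simp: rat_intervals_def)
  then show ?thesis by (rule countable_subset) (auto intro: countable_rat)
qed

lemma rat_intervalsD: "J \<in> rat_intervals \<Longrightarrow> \<exists>a b. a < b \<and> J = {a<..<b}"
  by (auto simp: rat_intervals_def)

lemma rat_intervals_emeasure:
  assumes "J \<in> rat_intervals"
  shows "emeasure lborel J \<noteq> 0" "emeasure lborel J \<noteq> \<infinity>" "J \<in> sets borel"
  using rat_intervalsD[OF assms] by auto

lemma less_maximal_iff: "t < maximal M \<B> f x \<longleftrightarrow> (\<exists>R\<in>\<B>. x \<in> R \<and> t < average M R f)"
  by (auto simp: maximal_def less_SUP_iff indicator_def split: if_splits)

lemma maximal_measurable:
  assumes "countable \<B>" "\<B> \<subseteq> sets M"
  shows "maximal M \<B> f \<in> borel_measurable M"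
  unfolding maximal_def using assms by (intro borel_measurable_SUP borel_measurable_times) auto

text \<open>For each interval of a Vitali subfamily, \<open>t\<close> times its length is at most
  the integral of \<open>g\<close> over it. By disjointness these integrals add up to at most the
  full one; the 3 is the Vitali constant.\<close>

lemma weak_11_finite:
  assumes g[measurable]: "g \<in> borel_measurable lborel" and F: "finite F" "F \<subseteq> rat_intervals"
    and avg: "\<And>J. J \<in> F \<Longrightarrow> t < average lborel J g"
  shows "t * emeasure lborel (\<Union>F) \<le> 3 * (\<integral>\<^sup>+x. g x \<partial>lborel)"
proof -
  obtain D where D: "D \<subseteq> F" "disjoint D" "emeasure lborel (\<Union>F) \<le> 3 * (\<Sum>J\<in>D. emeasure lborel J)"
    using interval_vitali[OF F(1)] F(2) rat_intervalsD by blast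
  have fD: "finite D" using D(1) F(1) finite_subset by blast
  have J: "t * emeasure lborel J \<le> (\<integral>\<^sup>+x\<in>J. g x \<partial>lborel)" if "J \<in> D" for J
  proof -
    have "J \<in> rat_intervals" using that D F by auto
    note JJ = rat_intervals_emeasure[OF this]
    have "t * emeasure lborel J \<le> average lborel J g * emeasure lborel J"
      using avg[of J] that D(1) by (intro mult_right_mono) (auto simp: less_imp_le)
    also have "\<dots> = (\<integral>\<^sup>+x\<in>J. g x \<partial>lborel)"
      unfolding average_def ennreal_divide_times using JJ by (simp add: ennreal_divide_self less_top)
    finally show ?thesis .
  qed
  have ms: "J \<in> sets borel" if "J \<in> D" for J using rat_intervals_emeasure that D F by blast
  have "t * emeasure lborel (\<Union>F) \<le> t * (3 * (\<Sum>J\<in>D. emeasure lborel J))"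
    by (intro mult_left_mono D) auto
  also have "\<dots> = 3 * (\<Sum>J\<in>D. t * emeasure lborel J)"
    by (simp add: sum_distrib_left mult_ac)
  also have "\<dots> \<le> 3 * (\<Sum>J\<in>D. \<integral>\<^sup>+x\<in>J. g x \<partial>lborel)"
    by (intro mult_left_mono sum_mono J) auto
  also have "(\<Sum>J\<in>D. \<integral>\<^sup>+x\<in>J. g x \<partial>lborel) = (\<integral>\<^sup>+x. (\<Sum>J\<in>D. g x * indicator J x) \<partial>lborel)"
    using ms by (intro nn_integral_sum[symmetric]) auto
  also have "\<dots> \<le> (\<integral>\<^sup>+x. g x \<partial>lborel)"
  proof (intro nn_integral_mono)
    fix x
    have "(\<Sum>J\<in>D. indicator J x :: ennreal) = indicator (\<Union>D) x"
      using D(2) fD by (intro indicator_UN_disjoint[of D id, simplified, symmetric])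
        (auto simp: disjoint_family_on_def disjoint_def)
    then have "(\<Sum>J\<in>D. g x * indicator J x) = g x * indicator (\<Union>D) x"
      by (simp flip: sum_distrib_left)
    also have "\<dots> \<le> g x" by (auto simp: indicator_def)
    finally show "(\<Sum>J\<in>D. g x * indicator J x) \<le> g x" .
  qed
  finally show ?thesis by (simp add: mult_left_mono)
qed

lemma weak_11:
  assumes g[measurable]: "g \<in> borel_measurable lborel"
  shows "t * emeasure lborel {x. t < maximal lborel rat_intervals g x} \<le> 3 * (\<integral>\<^sup>+x. g x \<partial>lborel)"
proof -
  define F where "F = {J\<in>rat_intervals. t < average lborel J g}"
  have eq: "{x. t < maximal lborel rat_intervals g x} = \<Union>F"
    by (auto simp: less_maximal_iff F_def)
  show ?thesis
  proof (cases "F = {}")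
    case False
    have cF: "countable F" unfolding F_def using countable_rat_intervals countable_subset by fastforce
    \<comment> \<open>Finite initial segments of an enumeration of \<open>F\<close> exhaust the
      level set, and continuity from below carries over the bound, which does not depend on
      \<open>n\<close>.\<close>
    define G where "G n = from_nat_into F ` {..n}" for n :: nat
    have GF: "G n \<subseteq> F" for n using from_nat_into[OF False] by (auto simp: G_def)
    have U: "\<Union>F = (\<Union>n. \<Union>(G n))"
      by (subst (1) range_from_nat_into[OF False cF, symmetric]) (auto simp: G_def)
    have ms: "\<Union>(G n) \<in> sets lborel" for n
      using GF[of n] rat_intervals_emeasure(3) by (intro sets.finite_Union) (auto simp: G_def F_def)
    have "emeasure lborel (\<Union>F) = (SUP n. emeasure lborel (\<Union>(G n)))"
      unfolding U using ms by (intro SUP_emeasure_incseq[symmetric])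
        (auto simp: incseq_def G_def intro: order_trans)
    then have "t * emeasure lborel (\<Union>F) = (SUP n. t * emeasure lborel (\<Union>(G n)))"
      by (simp add: SUP_mult_left_ennreal)
    also have "\<dots> \<le> 3 * (\<integral>\<^sup>+x. g x \<partial>lborel)"
      using GF by (intro SUP_least weak_11_finite) (auto simp: G_def F_def)
    finally show ?thesis unfolding eq .
  qed (simp add: eq)
qed

text \<open>The part of \<open>g\<close> not exceeding \<open>t / 2\<close> contributes at most
  \<open>t / 2\<close> to any average, so an average of \<open>g\<close> above \<open>t\<close>
  forces the average of the remaining part \<open>h\<close> above \<open>t / 2\<close>. The weak
  bound for \<open>h\<close> at that level has the constant \<open>3 / (t / 2)\<close>.\<close>

lemma weak_11_truncated:
  assumes g[measurable]: "g \<in> borel_measurable lborel" and t: "t > (0::real)"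
  shows "emeasure lborel {x. ennreal t < maximal lborel rat_intervals g x} \<le>
     ennreal (6 / t) * (\<integral>\<^sup>+x. g x * indicator {ennreal (t / 2)<..} (g x) \<partial>lborel)"
proof -
  define h where "h x = g x * indicator {ennreal (t / 2)<..} (g x)" for x
  have h[measurable]: "h \<in> borel_measurable lborel" unfolding h_def by measurable
  have "{x. ennreal t < maximal lborel rat_intervals g x} \<subseteq>
        {x. ennreal (t/2) < maximal lborel rat_intervals h x}"
  proof (clarsimp simp: less_maximal_iff)
    fix x J assume J: "J \<in> rat_intervals" "x \<in> J" "ennreal t < average lborel J g"
    note JJ = rat_intervals_emeasure[OF J(1)]
    note [measurable] = JJ(3)
    have le: "g y \<le> h y + ennreal (t/2)" for y
      by (auto simp: h_def indicator_def not_less)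
    have "(\<integral>\<^sup>+y\<in>J. g y \<partial>lborel) \<le> (\<integral>\<^sup>+y. h y * indicator J y + ennreal (t/2) * indicator J y \<partial>lborel)"
      using le by (intro nn_integral_mono) (auto simp: indicator_def)
    also have "\<dots> = (\<integral>\<^sup>+y\<in>J. h y \<partial>lborel) + ennreal (t/2) * emeasure lborel J"
      by (subst nn_integral_add) (auto simp: nn_integral_cmult)
    finally have "average lborel J g \<le> ((\<integral>\<^sup>+y\<in>J. h y \<partial>lborel) + ennreal (t/2) * emeasure lborel J) / emeasure lborel J"
      unfolding average_def by (rule divide_right_mono_ennreal)
    also have "\<dots> = average lborel J h + ennreal (t/2)"
      unfolding average_def using JJ by (simp add: add_divide_distrib_ennreal ennreal_mult_divide_eq)
    finally have "ennreal t < average lborel J h + ennreal (t/2)" using J(3) by simp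
    moreover have "ennreal t = ennreal (t/2) + ennreal (t/2)" using t by (simp flip: ennreal_plus)
    ultimately have "ennreal (t/2) < average lborel J h"
      by (metis ennreal_add_left_cancel_less add.commute)
    then show "\<exists>R\<in>rat_intervals. x \<in> R \<and> ennreal (t/2) < average lborel R h" using J by blast
  qed
  moreover have "maximal lborel rat_intervals h \<in> borel_measurable lborel"
    using countable_rat_intervals rat_intervals_emeasure by (intro maximal_measurable) auto
  ultimately have 1: "emeasure lborel {x. ennreal t < maximal lborel rat_intervals g x} \<le>
        emeasure lborel {x. ennreal (t/2) < maximal lborel rat_intervals h x}"
    by (intro emeasure_mono) auto
  have "emeasure lborel {x. ennreal (t/2) < maximal lborel rat_intervals h x}
     = ennreal (2/t) * (ennreal (t/2) * emeasure lborel {x. ennreal (t/2) < maximal lborel rat_intervals h x})"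
    using t ennreal_mult[of "2/t" "t/2"] by (simp flip: mult.assoc)
  also have "\<dots> \<le> ennreal (2/t) * (3 * (\<integral>\<^sup>+x. h x \<partial>lborel))"
    by (intro mult_left_mono weak_11) auto
  also have "\<dots> = ennreal (6/t) * (\<integral>\<^sup>+x. h x \<partial>lborel)"
    using t ennreal_mult[of "2/t" 3] by (simp flip: mult.assoc)
  finally show ?thesis using 1 unfolding h_def by simp
qed

text \<open>These are binomial coefficients: \<open>iterated_sum (Suc k) j\<close> equals
  \<open>(j + k) choose k\<close>. With \<open>j\<close> of the order of \<open>log u\<close>, every
  further summation contributes one logarithm.\<close>

fun iterated_sum :: "nat \<Rightarrow> nat \<Rightarrow> nat" where
  "iterated_sum 0 j = (if j = 0 then 1 else 0)"
| "iterated_sum (Suc k) j = (\<Sum>i\<le>j. iterated_sum k i)"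

lemma iterated_sum_0_pos: "iterated_sum k 0 = 1"
  by (induction k) auto

lemma iterated_sum_Suc_pos: "iterated_sum (Suc k) j \<ge> 1"
  using member_le_sum[of 0 "{..j}" "iterated_sum k"] by (simp add: iterated_sum_0_pos)

lemma iterated_sum_le: "iterated_sum (Suc k) j \<le> (j + 1) ^ k"
proof (induction k arbitrary: j)
  case 0
  then show ?case by (simp add: sum.delta)
next
  case (Suc k)
  have "iterated_sum (Suc (Suc k)) j = (\<Sum>i\<le>j. iterated_sum (Suc k) i)" by simp
  also have "\<dots> \<le> (\<Sum>i\<le>j. (j + 1) ^ k)"
    by (intro sum_mono order_trans[OF Suc.IH] power_mono) auto
  finally show ?case by simp
qed

text \<open>A dyadic step function comparable to \<open>u (1 + log\<^sup>+ u) ^ (k - 1)\<close> on \<open>u > 2 ^ -k\<close> and 0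
  elsewhere (and the indicator of \<open>u > 1\<close> for \<open>k = 0\<close>).  The coefficients are chosen such that
  replacing every level \<open>{Mg > s}\<close> by the bound \<open>(6 / s) \<integral>\<^bsub>g > s/2\<^esub> g\<close> turns the weight \<open>k\<close>
  into the weight \<open>k + 1\<close>.\<close>

definition llog_step :: "nat \<Rightarrow> ennreal \<Rightarrow> ennreal" where
  "llog_step k u = (\<Sum>j. ennreal (2 ^ j * real (iterated_sum k j)) * indicator {ennreal (2 ^ j / 2 ^ k)<..} u)"

lemma llog_step_measurable[measurable]: "llog_step k \<in> borel_measurable borel"
  unfolding llog_step_def by measurable

lemma suminf_ge_term: "(f j :: ennreal) \<le> (\<Sum>j. f j)"
  using sum_le_suminf[of f "{j}"] by simp

lemma llog_step_top: "llog_step (Suc k) top = top"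
proof (rule ccontr)
  assume "llog_step (Suc k) top \<noteq> top"
  then obtain n :: nat where n: "llog_step (Suc k) top < of_nat n"
    using ennreal_Ex_less_of_nat less_top by blast
  have "real n \<le> 2 ^ n * 1" using of_nat_less_two_power[of n, where ?'a=real] by simp
  also have "\<dots> \<le> 2 ^ n * real (iterated_sum (Suc k) n)"
    using iterated_sum_Suc_pos[of k n] by (intro mult_left_mono) (auto simp del: iterated_sum.simps)
  finally have "of_nat n \<le> ennreal (2 ^ n * real (iterated_sum (Suc k) n))"
    by (metis ennreal_leI ennreal_of_nat_eq_real_of_nat)
  also have "\<dots> = ennreal (2 ^ n * real (iterated_sum (Suc k) n)) * indicator {ennreal (2 ^ n / 2 ^ Suc k)<..} top"
    by (simp add: indicator_def del: iterated_sum.simps)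
  also have "\<dots> \<le> llog_step (Suc k) top"
    unfolding llog_step_def by (rule suminf_ge_term)
  finally show False using n by simp
qed

lemma dyadic_bracket:
  fixes c g :: real
  assumes "0 < c" "c < g"
  obtains N :: nat where "2 ^ N * c < g" "g \<le> 2 ^ Suc N * c"
proof -
  obtain M :: nat where "g / c < 2 ^ M" using real_arch_pow[of 2 "g / c"] by auto
  then have ex: "g \<le> 2 ^ M * c" using assms by (simp add: field_simps)
  define L where "L = (LEAST M. g \<le> 2 ^ M * c)"
  have L: "g \<le> 2 ^ L * c" unfolding L_def using ex by (rule LeastI)
  have "L \<noteq> 0" using L assms by (intro notI) simp
  then obtain N where N: "L = Suc N" by (cases L) auto
  have "\<not> g \<le> 2 ^ N * c" using not_less_Least[of N "\<lambda>M. g \<le> 2 ^ M * c"] N L_def by simp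
  then show ?thesis using that[of N] L N by simp
qed

text \<open>If \<open>2 ^ N < 2 ^ Suc k * g \<le> 2 ^ Suc N\<close>, exactly the terms
  \<open>j \<le> N\<close> are active and sum to \<open>iterated_sum (Suc k) N\<close>, while
  \<open>2 ^ k * g \<le> 2 ^ N\<close>. Thus the single term \<open>N\<close> of the next weight
  already dominates the left-hand side.\<close>

lemma llog_step_Suc_ge:
  "ennreal (2 ^ k) * (g * (\<Sum>j. ennreal (real (iterated_sum k j)) * indicator {ennreal (2 ^ j / 2 ^ Suc k)<..} g))
    \<le> llog_step (Suc k) g"
proof (cases g)
  case top
  then show ?thesis by (simp add: llog_step_top)
next
  case (real r)
  show ?thesis
  proof (cases "r \<le> 1 / 2 ^ Suc k")
    case True
    have "\<not> 2 ^ j / 2 ^ Suc k < r" for j :: nat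
    proof -
      have "(1::real) / 2 ^ Suc k \<le> 2 ^ j / 2 ^ Suc k" by (intro divide_right_mono) auto
      then show ?thesis using True by linarith
    qed
    then show ?thesis using real by (simp add: indicator_def ennreal_less_iff)
  next
    case False
    obtain N where N: "2 ^ N * (1 / 2 ^ Suc k) < r" "r \<le> 2 ^ Suc N * (1 / 2 ^ Suc k)"
      using dyadic_bracket[of "1 / 2 ^ Suc k" r] False by auto
    have out: "\<not> 2 ^ j / 2 ^ Suc k < r" if "j > N" for j
    proof -
      have "(2::real) ^ Suc N / 2 ^ Suc k \<le> 2 ^ j / 2 ^ Suc k"
        using that by (intro divide_right_mono power_increasing) auto
      then show ?thesis using N(2) by simp
    qed
    have in': "2 ^ j / 2 ^ Suc k < r" if "j \<le> N" for j
    proof -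
      have "(2::real) ^ j / 2 ^ Suc k \<le> 2 ^ N / 2 ^ Suc k"
        using that by (intro divide_right_mono power_increasing) auto
      then show ?thesis using N(1) by simp
    qed
    have "(\<Sum>j. ennreal (real (iterated_sum k j)) * indicator {ennreal (2 ^ j / 2 ^ Suc k)<..} g)
       = (\<Sum>j\<in>{..N}. ennreal (real (iterated_sum k j)) * indicator {ennreal (2 ^ j / 2 ^ Suc k)<..} g)"
      using out real by (intro suminf_finite) (auto simp: indicator_def ennreal_less_iff)
    also have "\<dots> = (\<Sum>j\<in>{..N}. ennreal (real (iterated_sum k j)))"
      using in' real by (intro sum.cong) (auto simp: indicator_def ennreal_less_iff)
    also have "\<dots> = ennreal (real (iterated_sum (Suc k) N))"
      by (subst sum_ennreal) auto
    finally have "ennreal (2 ^ k) * (g * (\<Sum>j. ennreal (real (iterated_sum k j)) * indicator {ennreal (2 ^ j / 2 ^ Suc k)<..} g))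
       = ennreal (2 ^ k * r * real (iterated_sum (Suc k) N))"
      using real by (simp add: ennreal_mult mult.assoc del: iterated_sum.simps)
    also have "\<dots> \<le> ennreal (2 ^ N * real (iterated_sum (Suc k) N))"
      using N(2) by (intro ennreal_leI mult_right_mono of_nat_0_le_iff) (simp add: field_simps)
    also have "\<dots> = ennreal (2 ^ N * real (iterated_sum (Suc k) N)) * indicator {ennreal (2 ^ N / 2 ^ Suc k)<..} g"
      using in'[of N] real by (simp add: indicator_def ennreal_less_iff)
    also have "\<dots> \<le> llog_step (Suc k) g"
      unfolding llog_step_def by (rule suminf_ge_term)
    finally show ?thesis .
  qed
qed

text \<open>The weight is a sum of indicators of superlevel sets, so
  \<open>weak_11_truncated\<close> applies term by term. At level \<open>2 ^ j / 2 ^ k\<close> its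
  factor \<open>6 / t\<close> cancels the coefficient \<open>2 ^ j\<close>, and halving the level
  moves the thresholds to those of \<open>llog_step (Suc k)\<close>.\<close>

lemma llog_step_maximal_1d:
  assumes g[measurable]: "g \<in> borel_measurable lborel"
  shows "(\<integral>\<^sup>+u. llog_step k (maximal lborel rat_intervals g u) \<partial>lborel)
     \<le> 6 * (\<integral>\<^sup>+u. llog_step (Suc k) (g u) \<partial>lborel)"
proof -
  let ?M = "maximal lborel rat_intervals g" and ?t = "\<lambda>j. 2 ^ j / 2 ^ k :: real"
  have M[measurable]: "?M \<in> borel_measurable lborel"
    using countable_rat_intervals rat_intervals_emeasure by (intro maximal_measurable) auto
  have "(\<integral>\<^sup>+u. llog_step k (?M u) \<partial>lborel)
    = (\<Sum>j. ennreal (2 ^ j * real (iterated_sum k j)) * (\<integral>\<^sup>+u. indicator {ennreal (?t j)<..} (?M u) \<partial>lborel))"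
    unfolding llog_step_def by (subst nn_integral_suminf) (auto simp: nn_integral_cmult)
  also have "\<dots> \<le> (\<Sum>j. 6 * (ennreal (2 ^ k) * (ennreal (real (iterated_sum k j)) *
       (\<integral>\<^sup>+u. g u * indicator {ennreal (2 ^ j / 2 ^ Suc k)<..} (g u) \<partial>lborel))))"
  proof (intro suminf_le allI)
    fix j
    have "(\<integral>\<^sup>+u. indicator {ennreal (?t j)<..} (?M u) \<partial>lborel)
        = (\<integral>\<^sup>+u. indicator {u. ennreal (?t j) < ?M u} u \<partial>lborel)"
      by (intro nn_integral_cong) (auto simp: indicator_def)
    also have "\<dots> = emeasure lborel {u. ennreal (?t j) < ?M u}"
      by (rule nn_integral_indicator) measurable
    also have "\<dots> \<le> ennreal (6 / ?t j) * (\<integral>\<^sup>+u. g u * indicator {ennreal (?t j / 2)<..} (g u) \<partial>lborel)"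
      by (intro weak_11_truncated) auto
    finally have "ennreal (2 ^ j * real (iterated_sum k j)) * (\<integral>\<^sup>+u. indicator {ennreal (?t j)<..} (?M u) \<partial>lborel)
      \<le> ennreal (2 ^ j * real (iterated_sum k j)) * (ennreal (6 / ?t j) * (\<integral>\<^sup>+u. g u * indicator {ennreal (?t j / 2)<..} (g u) \<partial>lborel))"
      by (intro mult_left_mono) auto
    also have "\<dots> = ennreal (6 * 2 ^ k * real (iterated_sum k j)) * (\<integral>\<^sup>+u. g u * indicator {ennreal (?t j / 2)<..} (g u) \<partial>lborel)"
      by (simp add: mult.assoc[symmetric] ennreal_mult[symmetric]) (simp add: mult_ac)
    also have "\<dots> = 6 * (ennreal (2 ^ k) * (ennreal (real (iterated_sum k j)) *
       (\<integral>\<^sup>+u. g u * indicator {ennreal (2 ^ j / 2 ^ Suc k)<..} (g u) \<partial>lborel)))"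
      by (simp add: ennreal_mult mult.assoc mult.commute[of 2])
    finally show "ennreal (2 ^ j * real (iterated_sum k j)) * (\<integral>\<^sup>+u. indicator {ennreal (?t j)<..} (?M u) \<partial>lborel)
      \<le> 6 * (ennreal (2 ^ k) * (ennreal (real (iterated_sum k j)) *
       (\<integral>\<^sup>+u. g u * indicator {ennreal (2 ^ j / 2 ^ Suc k)<..} (g u) \<partial>lborel)))" .
  qed auto
  also have "\<dots> = 6 * (\<Sum>j. (\<integral>\<^sup>+u. ennreal (2 ^ k) * (g u * (ennreal (real (iterated_sum k j)) * indicator {ennreal (2 ^ j / 2 ^ Suc k)<..} (g u))) \<partial>lborel))"
  proof -
    have "(\<integral>\<^sup>+u. ennreal (2 ^ k) * (g u * (ennreal (real (iterated_sum k j)) * indicator {ennreal (2 ^ j / 2 ^ Suc k)<..} (g u))) \<partial>lborel)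
      = (\<integral>\<^sup>+u. (ennreal (2 ^ k) * ennreal (real (iterated_sum k j))) * (g u * indicator {ennreal (2 ^ j / 2 ^ Suc k)<..} (g u)) \<partial>lborel)" for j
      by (intro nn_integral_cong) (simp only: mult_ac)
    then show ?thesis by (simp add: nn_integral_cmult mult.assoc del: power_Suc)
  qed
  also have "\<dots> = 6 * (\<integral>\<^sup>+u. ennreal (2 ^ k) * (g u * (\<Sum>j. ennreal (real (iterated_sum k j)) * indicator {ennreal (2 ^ j / 2 ^ Suc k)<..} (g u))) \<partial>lborel)"
    by (subst nn_integral_suminf[symmetric]) (auto simp del: power_Suc)
  also have "\<dots> \<le> 6 * (\<integral>\<^sup>+u. llog_step (Suc k) (g u) \<partial>lborel)"
    by (intro mult_left_mono nn_integral_mono llog_step_Suc_ge) auto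
  finally show ?thesis .
qed

text \<open>Boxes are first taken in products over an arbitrary finite index set, so that
  coordinates can be added one at a time by induction.\<close>

definition rat_boxes :: "'i set \<Rightarrow> ('i \<Rightarrow> real) set set" where
  "rat_boxes I = PiE I ` (PiE I (\<lambda>_. rat_intervals))"

abbreviation lebPi :: "'i set \<Rightarrow> ('i \<Rightarrow> real) measure" where
  "lebPi I \<equiv> PiM I (\<lambda>_. lborel)"

lemma rat_boxes_measurable:
  assumes "finite I"
  shows "countable (rat_boxes I)" "rat_boxes I \<subseteq> sets (lebPi I)"
proof -
  show "countable (rat_boxes I)"
    unfolding rat_boxes_def using assms countable_rat_intervals
    by (intro countable_image countable_PiE) auto
  show "rat_boxes I \<subseteq> sets (lebPi I)"
    using assms by (auto simp: rat_boxes_def PiE_iff intro!: sets_PiM_I_finite rat_intervals_emeasure(3))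
qed

lemma rat_boxes_emeasure:
  assumes "finite I" "R \<in> rat_boxes I"
  shows "emeasure (lebPi I) R \<noteq> 0" "emeasure (lebPi I) R \<noteq> \<infinity>"
proof -
  interpret product_sigma_finite "\<lambda>_::'a. lborel :: real measure" by standard
  obtain J where J: "J \<in> PiE I (\<lambda>_. rat_intervals)" "R = PiE I J"
    using assms(2) by (auto simp: rat_boxes_def)
  then have Ji: "J i \<in> rat_intervals" if "i \<in> I" for i using that by auto
  have "emeasure (lebPi I) R = (\<Prod>i\<in>I. emeasure lborel (J i))"
    unfolding J(2) using assms(1) rat_intervals_emeasure(3)[OF Ji] by (intro emeasure_PiM) auto
  then show "emeasure (lebPi I) R \<noteq> 0" "emeasure (lebPi I) R \<noteq> \<infinity>"
    using rat_intervals_emeasure(1,2)[OF Ji] assms(1) by (auto simp: ennreal_prod_eq_top)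
qed

section \<open>The linear strong maximal function\<close>

interpretation lebPi: product_sigma_finite "\<lambda>_::'i. lborel :: real measure" by standard

lemma emeasure_times_average:
  assumes "emeasure M R \<noteq> 0" "emeasure M R \<noteq> \<infinity>"
  shows "emeasure M R * average M R f = (\<integral>\<^sup>+y\<in>R. f y \<partial>M)"
  unfolding average_def mult.commute[of "emeasure M R"] ennreal_divide_times
  using assms by (simp add: ennreal_divide_self less_top)

lemma ennreal_mult_divide_mult_cancel:
  fixes a b c :: ennreal
  assumes "c \<noteq> 0" "c \<noteq> \<infinity>" "b \<noteq> \<infinity>"
  shows "(c * a) / (c * b) = a / b"
proof -
  have "(c * a) / (c * b) = (c / c) * (a / b)"
    using assms by (simp add: divide_ennreal_def ennreal_inverse_mult less_top mult_ac)
  then show ?thesis using assms by (simp add: ennreal_divide_self less_top)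
qed

text \<open>Only \<open>j = 0\<close> survives, since \<open>iterated_sum 0\<close> vanishes
  elsewhere. The integral of this weight is the measure of a level set, which starts the induction
  on the dimension.\<close>

lemma llog_step_0: "llog_step 0 u = indicator {1<..} u"
proof -
  have "llog_step 0 u = (\<Sum>j\<in>{0}. ennreal (2 ^ j * real (iterated_sum 0 j)) * indicator {ennreal (2 ^ j / 2 ^ 0)<..} u)"
    unfolding llog_step_def by (rule suminf_finite) auto
  then show ?thesis by simp
qed

text \<open>Joint measurability in \<open>x\<close> and \<open>u\<close> is what Fubini needs later.
  The countable supremum reduces it to averages over a fixed interval, which are integrals depending
  on a parameter.\<close>

lemma measurable_slice_maximal:
  fixes f :: "('i \<Rightarrow> real) \<Rightarrow> ennreal"
  assumes "finite I" "i \<notin> I" and f: "f \<in> borel_measurable (lebPi (insert i I))"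
  shows "(\<lambda>(x, u). maximal lborel rat_intervals (\<lambda>v. f (x(i := v))) u) \<in> borel_measurable (lebPi I \<Otimes>\<^sub>M lborel)"
proof -
  have upd: "(\<lambda>z. (fst (fst z))(i := snd z)) \<in> measurable ((lebPi I \<Otimes>\<^sub>M lborel) \<Otimes>\<^sub>M lborel) (lebPi (insert i I))"
    by (rule measurable_fun_upd[where J=I]) (auto simp: assms)
  have "(\<lambda>z. f ((fst (fst z))(i := snd z))) \<in> borel_measurable ((lebPi I \<Otimes>\<^sub>M lborel) \<Otimes>\<^sub>M lborel)"
    using measurable_compose[OF upd f] .
  then have m: "(\<lambda>(z, v). f ((fst z)(i := v))) \<in> borel_measurable ((lebPi I \<Otimes>\<^sub>M lborel) \<Otimes>\<^sub>M lborel)"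
    by (simp add: case_prod_beta')
  have "(\<lambda>z. SUP J\<in>rat_intervals. average lborel J (\<lambda>v. f ((fst z)(i := v))) * indicator J (snd z))
       \<in> borel_measurable (lebPi I \<Otimes>\<^sub>M lborel)"
  proof (intro borel_measurable_SUP countable_rat_intervals)
    fix J assume "J \<in> rat_intervals"
    then have J[measurable]: "J \<in> sets borel" using rat_intervals_emeasure by blast
    have "(\<lambda>z. f ((fst (fst z))(i := snd z)) * indicator J (snd z)) \<in> borel_measurable ((lebPi I \<Otimes>\<^sub>M lborel) \<Otimes>\<^sub>M lborel)"
      using m by (intro borel_measurable_times_ennreal measurable_compose[OF measurable_snd borel_measurable_indicator])
        (auto simp: case_prod_beta')
    then have "(\<lambda>z. \<integral>\<^sup>+v. f ((fst z)(i := v)) * indicator J v \<partial>lborel) \<in> borel_measurable (lebPi I \<Otimes>\<^sub>M lborel)"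
      by (intro lborel.borel_measurable_nn_integral) (simp add: case_prod_beta')
    then show "(\<lambda>z. average lborel J (\<lambda>v. f ((fst z)(i := v))) * indicator J (snd z)) \<in> borel_measurable (lebPi I \<Otimes>\<^sub>M lborel)"
      unfolding average_def by measurable
  qed
  then show ?thesis by (simp add: maximal_def case_prod_beta')
qed

text \<open>By Fubini the average over the box is an average over \<open>x\<close> of averages along
  \<open>J i\<close>. Since \<open>u\<close> lies in \<open>J i\<close>, each inner average is
  bounded by the maximal function of the slice at the same point \<open>u\<close>, whatever
  \<open>x\<close> is.\<close>

lemma average_insert_le:
  fixes f :: "('i \<Rightarrow> real) \<Rightarrow> ennreal"
  assumes I: "finite I" "i \<notin> I" and f: "f \<in> borel_measurable (lebPi (insert i I))"
    and J: "J \<in> PiE (insert i I) (\<lambda>_. rat_intervals)" and u: "u \<in> J i"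
  shows "average (lebPi (insert i I)) (PiE (insert i I) J) f
     \<le> average (lebPi I) (PiE I J) (\<lambda>x. maximal lborel rat_intervals (\<lambda>v. f (x(i := v))) u)"
proof -
  have Jr: "J j \<in> rat_intervals" if "j \<in> insert i I" for j using J that by auto
  have Jm[measurable]: "J j \<in> sets borel" if "j \<in> insert i I" for j
    using rat_intervals_emeasure(3)[OF Jr[OF that]] .
  let ?R = "PiE (insert i I) J" and ?R' = "PiE I J"
  have Rm[measurable]: "?R \<in> sets (lebPi (insert i I))" "?R' \<in> sets (lebPi I)"
    using I Jm by (auto intro!: sets_PiM_I_finite)
  have em: "emeasure (lebPi (insert i I)) ?R = emeasure lborel (J i) * emeasure (lebPi I) ?R'"
    using I Jm by (simp add: lebPi.emeasure_PiM)
  have J0: "emeasure lborel (J i) \<noteq> 0" "emeasure lborel (J i) \<noteq> \<infinity>"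
    using rat_intervals_emeasure Jr by auto
  have R0: "emeasure (lebPi I) ?R' \<noteq> 0" "emeasure (lebPi I) ?R' \<noteq> \<infinity>"
  proof -
    have "?R' = PiE I (restrict J I)" by (intro PiE_cong) auto
    then have "?R' \<in> rat_boxes I" using J unfolding rat_boxes_def by (intro image_eqI[of _ _ "restrict J I"]) auto
    then show "emeasure (lebPi I) ?R' \<noteq> 0" "emeasure (lebPi I) ?R' \<noteq> \<infinity>"
      using rat_boxes_emeasure I by auto
  qed
  have "(\<integral>\<^sup>+z\<in>?R. f z \<partial>lebPi (insert i I))
     = (\<integral>\<^sup>+x. (\<integral>\<^sup>+v. f (x(i := v)) * indicator ?R (x(i := v)) \<partial>lborel) \<partial>lebPi I)"
    using f Rm(1)
    by (intro lebPi.product_nn_integral_insert I borel_measurable_times_ennreal borel_measurable_indicator)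
  also have "\<dots> = (\<integral>\<^sup>+x. emeasure lborel (J i) * (average lborel (J i) (\<lambda>v. f (x(i := v))) * indicator ?R' x) \<partial>lebPi I)"
  proof (rule nn_integral_cong)
    fix x assume x: "x \<in> space (lebPi I)"
    have ind: "indicator ?R (x(i := v)) = (indicator ?R' x * indicator (J i) v :: ennreal)" for v
    proof -
      have "x(i := v) \<in> ?R \<longleftrightarrow> x \<in> ?R' \<and> v \<in> J i"
        using x I(2) by (auto simp: space_PiM PiE_iff extensional_def)
      then show ?thesis by (auto simp: indicator_def)
    qed
    have fx: "(\<lambda>v. f (x(i := v))) \<in> borel_measurable lborel"
      using measurable_compose[OF measurable_component_update[OF x I(2)] f] .
    have "(\<integral>\<^sup>+v. f (x(i := v)) * indicator ?R (x(i := v)) \<partial>lborel)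
       = (\<integral>\<^sup>+v. (f (x(i := v)) * indicator (J i) v) * indicator ?R' x \<partial>lborel)"
      by (simp add: ind mult_ac)
    also have "\<dots> = (\<integral>\<^sup>+v\<in>J i. f (x(i := v)) \<partial>lborel) * indicator ?R' x"
      using fx Jm[of i]
      by (intro nn_integral_multc borel_measurable_times_ennreal borel_measurable_indicator) auto
    also have "(\<integral>\<^sup>+v\<in>J i. f (x(i := v)) \<partial>lborel) = emeasure lborel (J i) * average lborel (J i) (\<lambda>v. f (x(i := v)))"
      using emeasure_times_average[OF J0] by simp
    finally show "(\<integral>\<^sup>+v. f (x(i := v)) * indicator ?R (x(i := v)) \<partial>lborel)
       = emeasure lborel (J i) * (average lborel (J i) (\<lambda>v. f (x(i := v))) * indicator ?R' x)"
      unfolding mult.assoc .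
  qed
  also have "\<dots> \<le> (\<integral>\<^sup>+x. emeasure lborel (J i) * (maximal lborel rat_intervals (\<lambda>v. f (x(i := v))) u * indicator ?R' x) \<partial>lebPi I)"
  proof (intro nn_integral_mono mult_left_mono mult_right_mono)
    fix x :: "'i \<Rightarrow> real"
    show "average lborel (J i) (\<lambda>v. f (x(i := v))) \<le> maximal lborel rat_intervals (\<lambda>v. f (x(i := v))) u"
      unfolding maximal_def using u Jr by (intro SUP_upper2[of "J i"]) auto
  qed auto
  also have "\<dots> = emeasure lborel (J i) * (\<integral>\<^sup>+x\<in>?R'. maximal lborel rat_intervals (\<lambda>v. f (x(i := v))) u \<partial>lebPi I)"
  proof (rule nn_integral_cmult)
    have "(\<lambda>x. (x, u)) \<in> measurable (lebPi I) (lebPi I \<Otimes>\<^sub>M lborel)" by simp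
    from measurable_compose[OF this measurable_slice_maximal[OF I f]]
    have "(\<lambda>x. maximal lborel rat_intervals (\<lambda>v. f (x(i := v))) u) \<in> borel_measurable (lebPi I)" by simp
    then show "(\<lambda>x. maximal lborel rat_intervals (\<lambda>v. f (x(i := v))) u * indicator ?R' x) \<in> borel_measurable (lebPi I)"
      by measurable
  qed
  finally have le: "(\<integral>\<^sup>+z\<in>?R. f z \<partial>lebPi (insert i I))
     \<le> emeasure lborel (J i) * (\<integral>\<^sup>+x\<in>?R'. maximal lborel rat_intervals (\<lambda>v. f (x(i := v))) u \<partial>lebPi I)" .
  have "average (lebPi (insert i I)) ?R f
      \<le> (emeasure lborel (J i) * (\<integral>\<^sup>+x\<in>?R'. maximal lborel rat_intervals (\<lambda>v. f (x(i := v))) u \<partial>lebPi I))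
        / (emeasure lborel (J i) * emeasure (lebPi I) ?R')"
    unfolding average_def em by (rule divide_right_mono_ennreal[OF le])
  also have "\<dots> = average (lebPi I) ?R' (\<lambda>x. maximal lborel rat_intervals (\<lambda>v. f (x(i := v))) u)"
    unfolding average_def using J0 R0 by (simp add: ennreal_mult_divide_mult_cancel)
  finally show ?thesis .
qed

text \<open>The average over \<open>R \<times> J\<close> is an average over \<open>R\<close> of averages over \<open>J\<close>, so each new coordinate
  costs one application of the one-dimensional maximal operator, that is, one step of the weight.\<close>

theorem strong_maximal_weak_type:
  fixes f :: "('i \<Rightarrow> real) \<Rightarrow> ennreal"
  assumes "finite I" "f \<in> borel_measurable (lebPi I)"
  shows "emeasure (lebPi I) {x\<in>space (lebPi I). 1 < maximal (lebPi I) (rat_boxes I) f x}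
     \<le> 6 ^ card I * (\<integral>\<^sup>+x. llog_step (card I) (f x) \<partial>lebPi I)"
  using assms
proof (induction I arbitrary: f rule: finite_induct)
  case empty
  \<comment> \<open>The empty product is a single point of mass 1, so the only average is the value
    of \<open>f\<close> there.\<close>
  have rb: "rat_boxes {} = {{\<lambda>_::'i. undefined}}" by (auto simp: rat_boxes_def)
  have "maximal (lebPi {}) (rat_boxes {}) f x = f x" if "x \<in> space (lebPi {})" for x
    using that by (simp add: maximal_def rb average_def lebPi.nn_integral_empty space_PiM PiM_empty divide_ennreal_def)
  then have "emeasure (lebPi {}) {x\<in>space (lebPi {}). 1 < maximal (lebPi {}) (rat_boxes {}) f x}
     = emeasure (lebPi {}) {x\<in>space (lebPi {}). 1 < f x}"
    by (intro arg_cong2[where f=emeasure]) auto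
  also have "\<dots> = (\<integral>\<^sup>+x. indicator {x\<in>space (lebPi {}). 1 < f x} x \<partial>lebPi {})"
    using empty by (intro nn_integral_indicator[symmetric] borel_measurable_less) auto
  also have "\<dots> = (\<integral>\<^sup>+x. llog_step 0 (f x) \<partial>lebPi {})"
    by (intro nn_integral_cong) (auto simp: llog_step_0 indicator_def)
  finally show ?case by simp
next
  case (insert i I)
  note I = insert.hyps and f = insert.prems
  define h where "h x u = maximal lborel rat_intervals (\<lambda>v. f (x(i := v))) u" for x u
  have h: "(\<lambda>(x, u). h x u) \<in> borel_measurable (lebPi I \<Otimes>\<^sub>M lborel)"
    unfolding h_def by (rule measurable_slice_maximal[OF I f])
  interpret pair_sigma_finite "lebPi I" "lborel :: real measure"
    by (intro pair_sigma_finite.intro lebPi.sigma_finite I) (rule lborel.sigma_finite_measure_axioms)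
  have hl: "(\<lambda>(x, u). llog_step (card I) (h x u)) \<in> borel_measurable (lebPi I \<Otimes>\<^sub>M lborel)"
    using measurable_compose[OF h llog_step_measurable] by (simp add: case_prod_beta')
  have hu[measurable]: "(\<lambda>x. h x u) \<in> borel_measurable (lebPi I)" for u
    using measurable_compose[OF measurable_Pair2' h, of u] by simp
  define E where "E = {z\<in>space (lebPi (insert i I)). 1 < maximal (lebPi (insert i I)) (rat_boxes (insert i I)) f z}"
  have Em: "E \<in> sets (lebPi (insert i I))"
    unfolding E_def using rat_boxes_measurable[of "insert i I"] I(1)
    by (intro borel_measurable_less maximal_measurable) auto
  define E' where "E' u = {x\<in>space (lebPi I). 1 < maximal (lebPi I) (rat_boxes I) (\<lambda>x. h x u) x}" for u
  have E'm: "E' u \<in> sets (lebPi I)" for u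
    unfolding E'_def using rat_boxes_measurable[of I] I(1)
    by (intro borel_measurable_less maximal_measurable) auto
  \<comment> \<open>For fixed \<open>u\<close> the slice of \<open>E\<close> lies in a level set of
    the lower-dimensional maximal function of \<open>h _ u\<close>, to which the induction
    hypothesis applies.\<close>
  have sub: "x \<in> E' u" if x: "x \<in> space (lebPi I)" and xE: "x(i := u) \<in> E" for x u
  proof -
    obtain R where R: "R \<in> rat_boxes (insert i I)" "x(i := u) \<in> R" "1 < average (lebPi (insert i I)) R f"
      using xE by (auto simp: E_def less_maximal_iff)
    obtain J where J: "J \<in> PiE (insert i I) (\<lambda>_. rat_intervals)" "R = PiE (insert i I) J"
      using R(1) unfolding rat_boxes_def by blast
    have u: "u \<in> J i" using R(2) J(2) by (auto simp: PiE_iff)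
    have "1 < average (lebPi I) (PiE I J) (\<lambda>x. h x u)"
      using less_le_trans[OF R(3)[unfolded J(2)] average_insert_le[OF I f J(1) u]] unfolding h_def .
    moreover have "x \<in> PiE I J"
      using R(2) x I(2) unfolding J(2) by (auto simp: PiE_iff space_PiM split: if_splits)
    moreover have "PiE I J \<in> rat_boxes I"
    proof -
      have "PiE I J = PiE I (restrict J I)" by (intro PiE_cong) auto
      then show ?thesis using J unfolding rat_boxes_def by (intro image_eqI[of _ _ "restrict J I"]) auto
    qed
    ultimately show ?thesis unfolding E'_def less_maximal_iff using x by blast
  qed
  have "emeasure (lebPi (insert i I)) E = (\<integral>\<^sup>+z. indicator E z \<partial>lebPi (insert i I))"
    using Em by simp
  also have "\<dots> = (\<integral>\<^sup>+u. (\<integral>\<^sup>+x. indicator E (x(i := u)) \<partial>lebPi I) \<partial>lborel)"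
    using Em by (intro lebPi.product_nn_integral_insert_rev I) auto
  also have "\<dots> \<le> (\<integral>\<^sup>+u. (\<integral>\<^sup>+x. indicator (E' u) x \<partial>lebPi I) \<partial>lborel)"
    using sub by (intro nn_integral_mono) (auto simp: indicator_def)
  also have "\<dots> = (\<integral>\<^sup>+u. emeasure (lebPi I) (E' u) \<partial>lborel)"
    using E'm by simp
  also have "\<dots> \<le> (\<integral>\<^sup>+u. 6 ^ card I * (\<integral>\<^sup>+x. llog_step (card I) (h x u) \<partial>lebPi I) \<partial>lborel)"
    unfolding E'_def by (intro nn_integral_mono insert.IH hu)
  also have "\<dots> = 6 ^ card I * (\<integral>\<^sup>+u. (\<integral>\<^sup>+x. llog_step (card I) (h x u) \<partial>lebPi I) \<partial>lborel)"
    using measurable_pair_swap[OF hl]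
    by (intro nn_integral_cmult M1.borel_measurable_nn_integral) (simp add: case_prod_beta')
  finally have E_le: "emeasure (lebPi (insert i I)) E \<le> 6 ^ card I * (\<integral>\<^sup>+u. (\<integral>\<^sup>+x. llog_step (card I) (h x u) \<partial>lebPi I) \<partial>lborel)" .
  have "(\<integral>\<^sup>+u. (\<integral>\<^sup>+x. llog_step (card I) (h x u) \<partial>lebPi I) \<partial>lborel)
      = (\<integral>\<^sup>+x. (\<integral>\<^sup>+u. llog_step (card I) (h x u) \<partial>lborel) \<partial>lebPi I)"
    using hl by (rule Fubini')
  also have "\<dots> \<le> (\<integral>\<^sup>+x. 6 * (\<integral>\<^sup>+u. llog_step (Suc (card I)) (f (x(i := u))) \<partial>lborel) \<partial>lebPi I)"
  \<comment> \<open>After the exchange of integrals \<open>x\<close> is frozen, and the inner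
    integral is that of a one-dimensional maximal function: a factor 6 and one step of the
    weight.\<close>
  proof (rule nn_integral_mono)
    fix x assume x: "x \<in> space (lebPi I)"
    have "(\<lambda>v. f (x(i := v))) \<in> borel_measurable lborel"
      using measurable_compose[OF measurable_component_update[OF x I(2)] f] .
    then show "(\<integral>\<^sup>+u. llog_step (card I) (h x u) \<partial>lborel) \<le> 6 * (\<integral>\<^sup>+u. llog_step (Suc (card I)) (f (x(i := u))) \<partial>lborel)"
      unfolding h_def by (rule llog_step_maximal_1d)
  qed
  also have "\<dots> = 6 * (\<integral>\<^sup>+x. (\<integral>\<^sup>+u. llog_step (Suc (card I)) (f (x(i := u))) \<partial>lborel) \<partial>lebPi I)"
  proof (rule nn_integral_cmult)
    have upd: "(\<lambda>z. (fst z)(i := snd z)) \<in> measurable (lebPi I \<Otimes>\<^sub>M lborel) (lebPi (insert i I))"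
      by (rule measurable_fun_upd[where J=I]) auto
    have "(\<lambda>z. llog_step (Suc (card I)) (f ((fst z)(i := snd z)))) \<in> borel_measurable (lebPi I \<Otimes>\<^sub>M lborel)"
      using measurable_compose[OF measurable_compose[OF upd f] llog_step_measurable] .
    then show "(\<lambda>x. \<integral>\<^sup>+u. llog_step (Suc (card I)) (f (x(i := u))) \<partial>lborel) \<in> borel_measurable (lebPi I)"
      by (intro lborel.borel_measurable_nn_integral) (simp add: case_prod_beta')
  qed
  also have "(\<integral>\<^sup>+x. (\<integral>\<^sup>+u. llog_step (Suc (card I)) (f (x(i := u))) \<partial>lborel) \<partial>lebPi I)
      = (\<integral>\<^sup>+z. llog_step (Suc (card I)) (f z) \<partial>lebPi (insert i I))"
    using measurable_compose[OF f llog_step_measurable]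
    by (intro lebPi.product_nn_integral_insert[symmetric] I) auto
  finally have h_le: "(\<integral>\<^sup>+u. (\<integral>\<^sup>+x. llog_step (card I) (h x u) \<partial>lebPi I) \<partial>lborel)
      \<le> 6 * (\<integral>\<^sup>+z. llog_step (Suc (card I)) (f z) \<partial>lebPi (insert i I))" .
  have "emeasure (lebPi (insert i I)) E
      \<le> 6 ^ card I * (6 * (\<integral>\<^sup>+z. llog_step (Suc (card I)) (f z) \<partial>lebPi (insert i I)))"
    by (rule order_trans[OF E_le mult_left_mono[OF h_le]]) simp
  then show ?case
    using I unfolding E_def by (simp add: mult_ac)
qed

section \<open>Growth of the iterates of Phi\<close>

text \<open>Unlike \<open>log_plus\<close>, this is at least 1 and submultiplicative, so its powers
  can be estimated factor by factor.\<close>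

abbreviation one_log :: "real \<Rightarrow> real" where
  "one_log u \<equiv> 1 + log_plus u"

lemma log_plus_nonneg: "0 \<le> log_plus u"
  by (simp add: log_plus_def)

lemma log_plus_mono: "0 \<le> u \<Longrightarrow> u \<le> v \<Longrightarrow> log_plus u \<le> log_plus v"
  by (cases "u = 0") (auto simp: log_plus_def max_def)

lemma log_plus_mult: "0 \<le> a \<Longrightarrow> 0 \<le> b \<Longrightarrow> log_plus (a * b) \<le> log_plus a + log_plus b"
  by (cases "a = 0 \<or> b = 0") (auto simp: log_plus_def ln_mult add_mono)

lemma one_log_mult:
  assumes "0 \<le> a" "0 \<le> b"
  shows "one_log (a * b) \<le> one_log a * one_log b"
proof -
  have "0 \<le> log_plus a * log_plus b" by (simp add: log_plus_nonneg)
  then show ?thesis using log_plus_mult[OF assms] by (simp add: algebra_simps)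
qed

lemma log_plus_power: "0 \<le> u \<Longrightarrow> log_plus (u ^ p) \<le> real p * log_plus u"
proof (induction p)
  case 0
  then show ?case by (simp add: log_plus_def)
next
  case (Suc p)
  then show ?case using log_plus_mult[of u "u ^ p"] by (simp add: algebra_simps)
qed

lemma log_plus_le: "0 \<le> u \<Longrightarrow> log_plus u \<le> u"
  using ln_le_minus_one[of u] by (cases "u = 0") (auto simp: log_plus_def)

text \<open>Not even the smallest threshold, that of \<open>j = 0\<close>, is exceeded. This cut-off
  is what later bounds a large dilation \<open>t\<close> by a multiple of \<open>u\<close>.\<close>

lemma llog_step_eq_0:
  assumes "u \<le> 1 / 2 ^ n"
  shows "llog_step n (ennreal u) = 0"
proof -
  have "\<not> 2 ^ j / 2 ^ n < u" for j :: nat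
  proof -
    have "(1::real) / 2 ^ n \<le> 2 ^ j / 2 ^ n" by (intro divide_right_mono) auto
    then show ?thesis using assms by linarith
  qed
  then show ?thesis unfolding llog_step_def by (simp add: indicator_def ennreal_less_iff)
qed

text \<open>If \<open>N\<close> is the last active index, the sum is at most
  \<open>2 ^ Suc N * (N + 1) ^ (n - 1)\<close>. Here \<open>2 ^ N\<close> is less than
  \<open>2 ^ n * u\<close>, and taking logarithms bounds \<open>N + 1\<close> by
  \<open>(n + 2) * one_log u\<close>.\<close>

lemma llog_step_le:
  assumes "n \<ge> 1"
  shows "llog_step n (ennreal u) \<le> ennreal (2 ^ (n + 1) * (real n + 2) ^ (n - 1) * u * one_log u ^ (n - 1))"
proof (cases "u \<le> 1 / 2 ^ n")
  case True
  then show ?thesis by (simp add: llog_step_eq_0)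
next
  case False
  obtain k where k: "n = Suc k" using assms by (cases n) auto
  have u0: "u > 0" using False by (smt (verit) divide_pos_pos zero_less_power)
  obtain N where N: "2 ^ N * (1 / 2 ^ n) < u" "u \<le> 2 ^ Suc N * (1 / 2 ^ n)"
    using dyadic_bracket[of "1 / 2 ^ n" u] False by auto
  have out: "\<not> 2 ^ j / 2 ^ n < u" if "j > N" for j
  proof -
    have "(2::real) ^ Suc N / 2 ^ n \<le> 2 ^ j / 2 ^ n"
      using that by (intro divide_right_mono power_increasing) auto
    then show ?thesis using N(2) by simp
  qed
  have N_le: "real N + 1 \<le> (real n + 2) * one_log u"
  proof -
    have "2 ^ N < 2 ^ n * u" using N(1) by (simp add: field_simps)
    then have "ln (2 ^ N) < ln (2 ^ n * u)" using u0 by (subst ln_less_cancel_iff) auto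
    then have "real N * ln 2 < real n * ln 2 + ln u" using u0 by (simp add: ln_mult ln_realpow)
    moreover have "ln u \<le> log_plus u" by (simp add: log_plus_def)
    moreover have ln2: "ln (2::real) \<ge> 1 / 2" using ln2_ge_two_thirds by simp
    ultimately have lt: "(real N - real n) * ln 2 < log_plus u" by (simp add: algebra_simps)
    have "real N - real n \<le> 2 * log_plus u"
    proof (cases "N \<le> n")
      case False
      then have "(real N - real n) * (1/2) \<le> (real N - real n) * ln 2"
        using ln2 by (intro mult_left_mono) auto
      then have "(real N - real n) * (1/2) < log_plus u" using lt by (rule le_less_trans)
      then show ?thesis by simp
    qed (use log_plus_nonneg[of u] in simp)
    then have "real N + 1 \<le> (real n + 1) + 2 * log_plus u" by simp
    also have "\<dots> \<le> (real n + 2) * one_log u"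
      using log_plus_nonneg[of u] by (simp add: algebra_simps)
    finally show ?thesis .
  qed
  have "llog_step n (ennreal u) = (\<Sum>j\<in>{..N}. ennreal (2 ^ j * real (iterated_sum n j)) * indicator {ennreal (2 ^ j / 2 ^ n)<..} (ennreal u))"
    unfolding llog_step_def using out by (intro suminf_finite) (auto simp: indicator_def ennreal_less_iff)
  also have "\<dots> \<le> (\<Sum>j\<in>{..N}. ennreal (2 ^ j * (real N + 1) ^ k))"
  proof (rule sum_mono)
    fix j assume j: "j \<in> {..N}"
    have "real (iterated_sum n j) \<le> real ((j + 1) ^ k)"
      using iterated_sum_le[of k j] unfolding k by (rule of_nat_mono)
    also have "\<dots> \<le> (real N + 1) ^ k" using j by (simp add: power_mono)
    finally show "ennreal (2 ^ j * real (iterated_sum n j)) * indicator {ennreal (2 ^ j / 2 ^ n)<..} (ennreal u)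
        \<le> ennreal (2 ^ j * (real N + 1) ^ k)"
      by (auto simp: indicator_def intro!: ennreal_leI)
  qed
  also have "\<dots> = ennreal ((\<Sum>j\<le>N. 2 ^ j) * (real N + 1) ^ k)"
    by (simp add: sum_distrib_right)
  also have "\<dots> \<le> ennreal (2 ^ (n + 1) * (real n + 2) ^ (n - 1) * u * one_log u ^ (n - 1))"
  proof (rule ennreal_leI)
    have "(\<Sum>j\<le>N. 2 ^ j) = (2::real) ^ Suc N - 1"
      using sum_gp_basic[of "2::real" N] by simp
    also have "\<dots> \<le> 2 * 2 ^ N" by simp
    also have "\<dots> \<le> 2 ^ (n + 1) * u" using N(1) by (simp add: field_simps)
    finally have "(\<Sum>j\<le>N. (2::real) ^ j) * (real N + 1) ^ k \<le> (2 ^ (n + 1) * u) * ((real n + 2) * one_log u) ^ k"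
      using N_le u0 by (intro mult_mono power_mono) (auto intro: sum_nonneg)
    then show "(\<Sum>j\<le>N. (2::real) ^ j) * (real N + 1) ^ k
        \<le> 2 ^ (n + 1) * (real n + 2) ^ (n - 1) * u * one_log u ^ (n - 1)"
      by (simp add: k power_mult_distrib mult_ac)
  qed
  finally show ?thesis .
qed

section \<open>Two-sided bounds for \<open>Phi\<close> and its iterates\<close>

lemma Phi_ge_self: "0 \<le> u \<Longrightarrow> u \<le> Phi n u"
  using mult_left_mono[of 1 "1 + log_plus u ^ (n - 1)" u] by (simp add: Phi_def log_plus_nonneg)

lemma Phi_iter_ge_self: "0 \<le> u \<Longrightarrow> u \<le> (Phi n ^^ k) u"
proof (induction k)
  case (Suc k)
  then show ?case using Phi_ge_self[of "(Phi n ^^ k) u" n] by simp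
qed simp

lemma power_one_add_le:
  assumes "(0::real) \<le> a"
  shows "(1 + a) ^ p \<le> 2 ^ p * (1 + a ^ p)"
proof -
  have "(1 + a) ^ p \<le> (2 * max 1 a) ^ p" using assms by (intro power_mono) auto
  also have "\<dots> = 2 ^ p * max 1 a ^ p" by (simp add: power_mult_distrib)
  also have "\<dots> \<le> 2 ^ p * (1 + a ^ p)"
    using assms by (intro mult_left_mono) (auto simp: max_def)
  finally show ?thesis .
qed

lemma Phi_ge:
  assumes "0 \<le> u"
  shows "u * one_log u ^ (n - 1) \<le> 2 ^ (n - 1) * Phi n u"
  using mult_left_mono[OF power_one_add_le[OF log_plus_nonneg[of u], of "n - 1"] assms]
  by (simp add: Phi_def mult_ac)

lemma Phi_le:
  assumes "0 \<le> u"
  shows "Phi n u \<le> 2 * u * one_log u ^ (n - 1)"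
proof -
  have "1 \<le> one_log u ^ (n - 1)" "log_plus u ^ (n - 1) \<le> one_log u ^ (n - 1)"
    using log_plus_nonneg[of u] by (auto intro!: one_le_power power_mono)
  then have "u * (1 + log_plus u ^ (n - 1)) \<le> u * (2 * one_log u ^ (n - 1))"
    using assms by (intro mult_left_mono) auto
  then show ?thesis by (simp add: Phi_def)
qed

text \<open>The value \<open>?v\<close> of the previous iterate is at least \<open>u\<close>, so
  each new application of \<open>Phi\<close> supplies at least \<open>n - 1\<close> further factors
  \<open>one_log u\<close>, up to the constant from \<open>Phi_ge\<close>.\<close>

lemma Phi_iter_ge:
  assumes "0 \<le> u"
  shows "u * one_log u ^ (k * (n - 1)) \<le> 2 ^ (k * (n - 1)) * (Phi n ^^ k) u"
proof (induction k)
  case (Suc k)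
  let ?v = "(Phi n ^^ k) u"
  have v: "u \<le> ?v" using assms by (rule Phi_iter_ge_self)
  have "u * one_log u ^ (Suc k * (n - 1)) = (u * one_log u ^ (k * (n - 1))) * one_log u ^ (n - 1)"
    by (simp add: power_add mult_ac)
  also have "\<dots> \<le> (2 ^ (k * (n - 1)) * ?v) * one_log ?v ^ (n - 1)"
    using assms v log_plus_mono[OF assms v] log_plus_nonneg[of u]
    by (intro mult_mono Suc.IH power_mono) auto
  also have "\<dots> = 2 ^ (k * (n - 1)) * (?v * one_log ?v ^ (n - 1))" by simp
  also have "\<dots> \<le> 2 ^ (k * (n - 1)) * (2 ^ (n - 1) * Phi n ?v)"
    using assms v by (intro mult_left_mono Phi_ge) auto
  also have "\<dots> = 2 ^ (Suc k * (n - 1)) * (Phi n ^^ Suc k) u" by (simp add: power_add)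
  finally show ?case .
qed simp

text \<open>Conversely, an iterate is at most \<open>u\<close> times a power of
  \<open>one_log u\<close>, so its logarithm is at most a multiple of \<open>one_log u\<close>, and
  each application adds only \<open>n - 1\<close> logarithms. This is the bound needed for
  sharpness.\<close>

lemma Phi_iter_le:
  "\<exists>C\<ge>1. \<forall>u\<ge>0. (Phi n ^^ k) u \<le> C * u * one_log u ^ (k * (n - 1))"
proof (induction k)
  case 0
  show ?case by (intro exI[of _ 1]) simp
next
  case (Suc k)
  then obtain C where C: "C \<ge> 1" and le: "\<And>u. u \<ge> 0 \<Longrightarrow> (Phi n ^^ k) u \<le> C * u * one_log u ^ (k * (n - 1))"
    by blast
  define p where "p = k * (n - 1)"
  define A where "A = one_log C + 1 + real p"
  have A: "A \<ge> 1" using log_plus_nonneg[of C] by (simp add: A_def)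
  show ?case
  proof (intro exI[of _ "2 * C * A ^ (n - 1)"] conjI allI impI)
    show "1 \<le> 2 * C * A ^ (n - 1)"
      using C one_le_power[OF A, of "n - 1"] mult_mono[of 1 "2 * C" 1 "A ^ (n - 1)"] by simp
    fix u :: real assume u: "u \<ge> 0"
    let ?v = "(Phi n ^^ k) u" and ?L = "one_log u"
    have L: "?L \<ge> 1" using log_plus_nonneg[of u] by simp
    have v: "?v \<ge> 0" using Phi_iter_ge_self[OF u] u by (rule order_trans[rotated])
    have vle: "?v \<le> C * u * ?L ^ p" unfolding p_def by (rule le[OF u])
    have "log_plus ?v \<le> log_plus (C * u * ?L ^ p)" by (rule log_plus_mono[OF v vle])
    also have "\<dots> \<le> log_plus C + log_plus u + log_plus (?L ^ p)"
      using log_plus_mult[of "C * u" "?L ^ p"] log_plus_mult[of C u] C u L by simp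
    also have "log_plus (?L ^ p) \<le> real p * log_plus ?L" using L by (intro log_plus_power) simp
    \<comment> \<open>\<open>log_plus ?L\<close> is an iterated logarithm of \<open>u\<close>;
      bounding it by \<open>?L\<close> itself is crude but sufficient.\<close>
    also have "\<dots> \<le> real p * ?L" using log_plus_le[of ?L] L by (intro mult_left_mono) auto
    finally have "one_log ?v \<le> (1 + log_plus C) + log_plus u + real p * ?L" by simp
    also have "\<dots> \<le> (1 + log_plus C) * ?L + ?L + real p * ?L"
      using mult_left_mono[OF L, of "1 + log_plus C"] log_plus_nonneg[of C]
      by (intro add_mono) auto
    also have "\<dots> = A * ?L" by (simp add: A_def algebra_simps)
    finally have Lv: "one_log ?v \<le> A * ?L" .
    have "(Phi n ^^ Suc k) u = Phi n ?v" by simp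
    also have "\<dots> \<le> 2 * ?v * one_log ?v ^ (n - 1)" by (rule Phi_le[OF v])
    also have "\<dots> \<le> 2 * (C * u * ?L ^ p) * (A * ?L) ^ (n - 1)"
      using v vle Lv log_plus_nonneg[of ?v] C u L by (intro mult_mono power_mono) auto
    also have "\<dots> = 2 * C * A ^ (n - 1) * u * ?L ^ (Suc k * (n - 1))"
      by (simp add: p_def power_mult_distrib power_add mult_ac)
    finally show "(Phi n ^^ Suc k) u \<le> 2 * C * A ^ (n - 1) * u * ?L ^ (Suc k * (n - 1))" .
  qed
qed

section \<open>The effect of dilations on the weight\<close>

definition dilation_weight :: "nat \<Rightarrow> nat \<Rightarrow> real \<Rightarrow> real" where
  "dilation_weight m n t =
     (if t \<ge> 1 then 1 / (t * one_log t ^ ((m - 1) * (n - 1))) else one_log (1 / t) ^ (n - 1) / t)"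

lemma dilation_weight_nonneg: "t > 0 \<Longrightarrow> 0 \<le> dilation_weight m n t"
  using log_plus_nonneg[of t] log_plus_nonneg[of "1 / t"] by (auto simp: dilation_weight_def)

text \<open>For \<open>t \<ge> 1\<close> the weight vanishes unless \<open>t\<close> is at most a
  multiple of \<open>u\<close>, so the logarithms of \<open>u\<close> in the iterate that the weight
  does not use dominate those of \<open>t\<close>. For \<open>t < 1\<close> the logarithm of
  \<open>u / t\<close> splits into one of \<open>u\<close> and one of \<open>1 / t\<close>. The
  constant \<open>2 ^ (n + 1)\<close> anticipates a factor \<open>2 ^ n\<close> from enlarging boxes
  and a 2 from halving \<open>t\<close>.\<close>

lemma llog_step_le_dilation:
  assumes "n \<ge> 1" "m \<ge> 1"
  shows "\<exists>C>0. \<forall>t>0. \<forall>u\<ge>0.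
    llog_step n (ennreal (2 ^ (n + 1) * u / t)) \<le> ennreal (C * dilation_weight m n t * (Phi n ^^ m) u)"
proof -
  define C1 A B where "C1 = 2 ^ (n + 1) * (real n + 2) ^ (n - 1)"
    and "A = one_log (2 ^ (n + 1))" and "B = one_log (2 ^ (2 * n + 1))"
  let ?q = "(m - 1) * (n - 1)"
  define C where "C = C1 * 2 ^ (n + 1) * A ^ (n - 1) * B ^ ?q * 2 ^ (m * (n - 1))"
  have A: "A \<ge> 1" and B: "B \<ge> 1" and C1: "C1 > 0"
    by (auto simp: A_def B_def C1_def log_plus_nonneg)
  \<comment> \<open>Of the logarithms of \<open>u\<close> available, \<open>n - 1\<close> pay for
    the weight and \<open>?q\<close> are left for \<open>one_log t\<close>.\<close>
  have mn: "m * (n - 1) = ?q + (n - 1)" using assms(2) by (cases m) auto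
  show ?thesis
  proof (intro exI[of _ C] conjI allI impI)
    show "C > 0" using A B C1 by (simp add: C_def)
    fix t u :: real assume t: "t > 0" and u: "u \<ge> 0"
    define v where "v = 2 ^ (n + 1) * u / t"
    let ?L = "one_log u"
    have L: "?L \<ge> 1" using log_plus_nonneg[of u] by simp
    have Phi: "u * ?L ^ (m * (n - 1)) \<le> 2 ^ (m * (n - 1)) * (Phi n ^^ m) u" by (rule Phi_iter_ge[OF u])
    show "llog_step n (ennreal (2 ^ (n + 1) * u / t)) \<le> ennreal (C * dilation_weight m n t * (Phi n ^^ m) u)"
    proof (cases "v \<le> 1 / 2 ^ n")
      case True
      then show ?thesis using llog_step_eq_0[of v n] by (simp add: v_def)
    next
      case False
      have v0: "v \<ge> 0" using t u by (simp add: v_def)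
      have "C1 * v * one_log v ^ (n - 1) \<le> C * dilation_weight m n t * (Phi n ^^ m) u"
      proof (cases "t \<ge> 1")
        case True
        have "v \<le> 2 ^ (n + 1) * u" using True t u unfolding v_def
          using divide_left_mono[of 1 t "2 ^ (n + 1) * u"] by simp
        then have "one_log v \<le> one_log (2 ^ (n + 1) * u)" using log_plus_mono[OF v0] by simp
        also have "\<dots> \<le> A * ?L" unfolding A_def using u by (intro one_log_mult) auto
        finally have Lv: "one_log v \<le> A * ?L" .
        \<comment> \<open>Being above the cut-off turns into \<open>t < 2 ^ (2 * n + 1) * u\<close>,
          hence \<open>one_log t \<le> B * one_log u\<close>.\<close>
        have "1 < 2 ^ n * v" using False by (simp add: not_le divide_less_eq mult.commute)
        then have "1 < 2 ^ n * (2 ^ (n + 1) * u) / t" unfolding v_def times_divide_eq_right .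
        then have "t < 2 ^ n * (2 ^ (n + 1) * u)" by (subst (asm) pos_less_divide_eq[OF t]) (simp only: mult_1)
        also have "\<dots> = 2 ^ (2 * n + 1) * u" by (simp only: mult_2 power_add mult.assoc)
        finally have "one_log t \<le> one_log (2 ^ (2 * n + 1) * u)" using log_plus_mono[of t] t by simp
        also have "\<dots> \<le> B * ?L" unfolding B_def using u by (intro one_log_mult) auto
        finally have Lt: "one_log t \<le> B * ?L" .
        have "(v * one_log v ^ (n - 1)) * one_log t ^ ?q \<le> (v * (A * ?L) ^ (n - 1)) * (B * ?L) ^ ?q"
          using Lv Lt v0 log_plus_nonneg[of v] log_plus_nonneg[of t] A L
          by (intro mult_mono power_mono) auto
        also have "\<dots> = 2 ^ (n + 1) * A ^ (n - 1) * B ^ ?q / t * (u * ?L ^ (m * (n - 1)))"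
          unfolding mn by (simp add: v_def power_mult_distrib power_add mult_ac)
        also have "\<dots> \<le> 2 ^ (n + 1) * A ^ (n - 1) * B ^ ?q / t * (2 ^ (m * (n - 1)) * (Phi n ^^ m) u)"
          using A B t by (intro mult_left_mono Phi) auto
        finally have "C1 * ((v * one_log v ^ (n - 1)) * one_log t ^ ?q)
           \<le> C1 * (2 ^ (n + 1) * A ^ (n - 1) * B ^ ?q / t * (2 ^ (m * (n - 1)) * (Phi n ^^ m) u))"
          using C1 by (intro mult_left_mono) auto
        also have "\<dots> = C / t * (Phi n ^^ m) u" by (simp add: C_def mult_ac)
        finally have "(C1 * v * one_log v ^ (n - 1)) * one_log t ^ ?q \<le> C / t * (Phi n ^^ m) u"
          by (simp add: mult_ac)
        then have "C1 * v * one_log v ^ (n - 1) \<le> C / t * (Phi n ^^ m) u / one_log t ^ ?q"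
          using log_plus_nonneg[of t] by (subst pos_le_divide_eq) auto
        then show ?thesis using True by (simp add: dilation_weight_def mult_ac)
      next
        case t1: False
        have "v = 2 ^ (n + 1) * u * (1 / t)" by (simp add: v_def)
        then have "one_log v \<le> one_log (2 ^ (n + 1) * u) * one_log (1 / t)"
          using one_log_mult[of "2 ^ (n + 1) * u" "1 / t"] u t by simp
        also have "\<dots> \<le> (A * ?L) * one_log (1 / t)"
          unfolding A_def using u log_plus_nonneg[of "1 / t"] by (intro mult_right_mono one_log_mult) auto
        finally have Lv: "one_log v \<le> A * ?L * one_log (1 / t)" .
        have "v * one_log v ^ (n - 1) \<le> v * (A * ?L * one_log (1 / t)) ^ (n - 1)"
          using Lv v0 log_plus_nonneg[of v] by (intro mult_left_mono power_mono) auto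
        also have "\<dots> = 2 ^ (n + 1) * A ^ (n - 1) * (one_log (1 / t) ^ (n - 1) / t) * (u * ?L ^ (n - 1))"
          by (simp add: v_def power_mult_distrib mult_ac)
        also have "\<dots> \<le> 2 ^ (n + 1) * A ^ (n - 1) * (one_log (1 / t) ^ (n - 1) / t) * (2 ^ (m * (n - 1)) * (Phi n ^^ m) u)"
        proof (intro mult_left_mono)
          have "u * ?L ^ (n - 1) \<le> u * ?L ^ (m * (n - 1))"
            using u L mn by (intro mult_left_mono power_increasing) auto
          then show "u * ?L ^ (n - 1) \<le> 2 ^ (m * (n - 1)) * (Phi n ^^ m) u" using Phi by simp
        qed (use A t log_plus_nonneg[of "1 / t"] in auto)
        \<comment> \<open>The factor \<open>B ^ ?q \<ge> 1\<close> is inserted so that both cases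
          share the constant \<open>C\<close>.\<close>
        also have "\<dots> \<le> 2 ^ (n + 1) * A ^ (n - 1) * (one_log (1 / t) ^ (n - 1) / t) * (2 ^ (m * (n - 1)) * (Phi n ^^ m) u) * B ^ ?q"
        proof -
          have "(Phi n ^^ m) u \<ge> 0" using Phi_iter_ge_self[OF u, where n=n and k=m] u by simp
          then have "0 \<le> 2 ^ (n + 1) * A ^ (n - 1) * (one_log (1 / t) ^ (n - 1) / t) * (2 ^ (m * (n - 1)) * (Phi n ^^ m) u)"
            using A t log_plus_nonneg[of "1 / t"]
            by (intro mult_nonneg_nonneg divide_nonneg_nonneg zero_le_power) auto
          from mult_left_mono[OF one_le_power[OF B, of ?q] this] show ?thesis by simp
        qed
        finally have "C1 * (v * one_log v ^ (n - 1)) \<le> C1 * (2 ^ (n + 1) * A ^ (n - 1) * (one_log (1 / t) ^ (n - 1) / t) * (2 ^ (m * (n - 1)) * (Phi n ^^ m) u) * B ^ ?q)"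
          using C1 by (intro mult_left_mono) auto
        then show ?thesis using t1 by (simp add: dilation_weight_def C_def mult_ac)
      qed
      then have "ennreal (C1 * v * one_log v ^ (n - 1)) \<le> ennreal (C * dilation_weight m n t * (Phi n ^^ m) u)"
        by (rule ennreal_leI)
      then show ?thesis
        using llog_step_le[OF assms(1), of v] unfolding C1_def v_def by (rule order_trans[rotated])
    qed
  qed
qed

text \<open>Let \<open>T\<close> be the largest \<open>t i\<close>; it is at least 1. As the product
  is at least 1, no \<open>t i\<close> is below \<open>1 / T ^ (card I - 1)\<close>, so the other
  indices contribute at most \<open>(card I - 1) * (n - 1)\<close> factors \<open>one_log T\<close>,
  up to constants. The denominator of the weight at \<open>T\<close> cancels exactly these, and the
  factors \<open>1 / t i\<close> multiply to at most 1.\<close>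

lemma prod_dilation_weight_le:
  fixes t :: "'a \<Rightarrow> real"
  assumes I: "finite I" "I \<noteq> {}" and t: "\<And>i. i \<in> I \<Longrightarrow> t i > 0" and prod: "(\<Prod>i\<in>I. t i) \<ge> 1"
  shows "(\<Prod>i\<in>I. dilation_weight (card I) n (t i)) \<le> real (card I) ^ ((card I - 1) * (n - 1))"
proof -
  let ?m = "card I"
  have m: "?m \<ge> 1" using I by (simp add: Suc_le_eq card_gt_0_iff)
  have "Max (t ` I) \<in> t ` I" using I by (intro Max_in) auto
  then obtain i0 where i0: "i0 \<in> I" and mx: "t i0 = Max (t ` I)" by auto
  define T where "T = t i0"
  have T_max: "t i \<le> T" if "i \<in> I" for i using that I mx by (simp add: T_def)
  have T1: "T \<ge> 1"
  proof (rule ccontr)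
    assume "\<not> T \<ge> 1"
    then have "T < 1" by simp
    have "T > 0" using t[OF i0] by (simp add: T_def)
    have "(\<Prod>i\<in>I. t i) \<le> (\<Prod>i\<in>I. T)" using t T_max by (intro prod_mono) (auto simp: less_imp_le)
    also have "\<dots> \<le> T" using power_decreasing[of 1 ?m T] m \<open>T > 0\<close> \<open>T < 1\<close> by simp
    finally show False using prod \<open>T < 1\<close> by simp
  qed
  let ?L = "one_log T"
  have L: "?L \<ge> 1" by (simp add: log_plus_nonneg)
  \<comment> \<open>One bound for both branches of the weight: for \<open>t i \<ge> 1\<close> it is
    trivial, for \<open>t i < 1\<close> it uses that the remaining factors are at most
    \<open>T\<close>.\<close>
  have other: "dilation_weight ?m n (t i) \<le> (real ?m * ?L) ^ (n - 1) / t i" if i: "i \<in> I" for i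
  proof (cases "t i \<ge> 1")
    case True
    have "1 \<le> one_log (t i) ^ ((?m - 1) * (n - 1))" using log_plus_nonneg[of "t i"] by (intro one_le_power) simp
    then have "t i * 1 \<le> t i * one_log (t i) ^ ((?m - 1) * (n - 1))" using t[OF i] by (intro mult_left_mono) auto
    then have "dilation_weight ?m n (t i) \<le> 1 / t i"
      using True by (simp add: dilation_weight_def frac_le)
    also have "\<dots> \<le> (real ?m * ?L) ^ (n - 1) / t i"
      using m L t[OF i] mult_mono[of 1 "real ?m" 1 ?L] by (intro divide_right_mono one_le_power) auto
    finally show ?thesis .
  next
    case False
    have "1 / t i \<le> (\<Prod>j\<in>I - {i}. t j)"
      using prod t[OF i] I i by (simp add: prod.remove[of I i] divide_le_eq mult.commute)
    also have "\<dots> \<le> (\<Prod>j\<in>I - {i}. T)" using t T_max by (intro prod_mono) (auto simp: less_imp_le)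
    also have "\<dots> = T ^ (?m - 1)" using I i by simp
    finally have "log_plus (1 / t i) \<le> log_plus (T ^ (?m - 1))"
      using t[OF i] by (intro log_plus_mono) auto
    also have "\<dots> \<le> real (?m - 1) * log_plus T" using T1 by (intro log_plus_power) simp
    finally have "one_log (1 / t i) \<le> real ?m * ?L"
      using m log_plus_nonneg[of T] by (simp add: algebra_simps of_nat_diff)
    then have "one_log (1 / t i) ^ (n - 1) / t i \<le> (real ?m * ?L) ^ (n - 1) / t i"
      using t[OF i] log_plus_nonneg[of "1 / t i"] by (intro divide_right_mono power_mono) auto
    then show ?thesis using False by (simp add: dilation_weight_def)
  qed
  have "(\<Prod>i\<in>I. dilation_weight ?m n (t i))
     = dilation_weight ?m n T * (\<Prod>i\<in>I - {i0}. dilation_weight ?m n (t i))"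
    using I i0 by (simp add: prod.remove[of I i0] T_def)
  also have "\<dots> \<le> (1 / (T * ?L ^ ((?m - 1) * (n - 1)))) * (\<Prod>i\<in>I - {i0}. (real ?m * ?L) ^ (n - 1) / t i)"
    using T1 L t other dilation_weight_nonneg
    by (intro mult_mono prod_mono prod_nonneg) (auto simp: dilation_weight_def)
  also have "\<dots> = (1 / (T * ?L ^ ((?m - 1) * (n - 1)))) * ((real ?m * ?L) ^ ((n - 1) * (?m - 1)) / (\<Prod>i\<in>I - {i0}. t i))"
    using I i0 by (simp add: prod_dividef power_mult)
  also have "\<dots> = real ?m ^ ((?m - 1) * (n - 1)) / (T * (\<Prod>i\<in>I - {i0}. t i))"
    using L by (simp add: power_mult_distrib mult_ac)
  also have "T * (\<Prod>i\<in>I - {i0}. t i) = (\<Prod>i\<in>I. t i)"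
    using I i0 by (simp add: prod.remove[of I i0] T_def)
  also have "real ?m ^ ((?m - 1) * (n - 1)) / (\<Prod>i\<in>I. t i) \<le> real ?m ^ ((?m - 1) * (n - 1))"
    using prod m divide_left_mono[of 1 "\<Prod>i\<in>I. t i" "real ?m ^ ((?m - 1) * (n - 1))"] by simp
  finally show ?thesis .
qed

section \<open>Passage to Euclidean space\<close>

lemma prod_mono_ennreal:
  fixes f g :: "'a \<Rightarrow> ennreal"
  shows "(\<And>i. i \<in> I \<Longrightarrow> f i \<le> g i) \<Longrightarrow> (\<Prod>i\<in>I. f i) \<le> (\<Prod>i\<in>I. g i)"
  by (induction I rule: infinite_finite_induct) (auto intro!: mult_mono)

lemma prod_Basis_cart: "(\<Prod>b\<in>Basis. f (b :: real^'n)) = (\<Prod>i\<in>UNIV. f (axis i 1))"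
proof -
  have B: "(Basis :: (real^'n) set) = range (\<lambda>i. axis i 1)" by (auto simp: Basis_vec_def)
  have "inj (\<lambda>i. axis i 1 :: real^'n)" by (auto simp: inj_on_def axis_eq_axis)
  then show ?thesis unfolding B by (subst prod.reindex) auto
qed

lemma emeasure_box_cart:
  fixes a b :: "real^'n"
  assumes "\<And>i. a $ i \<le> b $ i"
  shows "emeasure lborel (box a b) = ennreal (\<Prod>i\<in>UNIV. b $ i - a $ i)"
proof -
  have "\<forall>c\<in>Basis. a \<bullet> c \<le> b \<bullet> c" using assms by (auto simp: Basis_vec_def inner_axis)
  then show ?thesis by (subst emeasure_lborel_box_eq) (simp add: prod_Basis_cart inner_axis)
qed

lemma emeasure_box_cart_nontrivial:
  fixes a b :: "real^'n"
  assumes "\<And>i. a $ i < b $ i"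
  shows "emeasure lborel (box a b) \<noteq> 0" "emeasure lborel (box a b) \<noteq> \<infinity>"
proof -
  define P where "P = (\<Prod>i\<in>UNIV. b $ i - a $ i)"
  have "P > 0" unfolding P_def using assms by (intro prod_pos) auto
  moreover have "emeasure lborel (box a b) = ennreal P"
    unfolding P_def using assms by (intro emeasure_box_cart) (simp add: less_imp_le)
  ultimately show "emeasure lborel (box a b) \<noteq> 0" "emeasure lborel (box a b) \<noteq> \<infinity>" by auto
qed

lemma measurable_vec_lambda: "vec_lambda \<in> borel_measurable (lebPi (UNIV :: 'n::finite set))"
proof (subst borel_measurable_euclidean_space, rule ballI)
  fix b :: "real^'n" assume "b \<in> Basis"
  then obtain i where b: "b = axis i 1" by (auto simp: Basis_vec_def)
  have "(\<lambda>x. x i) \<in> measurable (lebPi (UNIV :: 'n set)) lborel" by (rule measurable_component_singleton) simp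
  then show "(\<lambda>x. vec_lambda x \<bullet> b) \<in> borel_measurable (lebPi UNIV)" by (simp add: b inner_axis)
qed

lemma vimage_vec_lambda_box:
  "vec_lambda -` box a b \<inter> space (lebPi UNIV) = PiE UNIV (\<lambda>i. {a $ i<..<b $ i})"
  by (auto simp: mem_box_cart space_PiM PiE_iff)

text \<open>Lebesgue measure is determined by its values on boxes. This identity transports the
  estimate from product spaces to \<open>real^'n\<close>.\<close>

lemma lborel_cart: "(lborel :: (real^'n) measure) = distr (lebPi UNIV) borel vec_lambda"
proof (rule lborel_eqI)
  fix l u :: "real^'n" assume "\<And>b. b \<in> Basis \<Longrightarrow> l \<bullet> b \<le> u \<bullet> b"
  then have le: "l $ i \<le> u $ i" for i
    using axis_in_Basis_iff[of i "1::real"] by (metis Basis_real_def cart_eq_inner_axis singletonI)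
  have "emeasure (distr (lebPi UNIV) borel vec_lambda) (box l u)
      = emeasure (lebPi UNIV) (PiE UNIV (\<lambda>i. {l $ i<..<u $ i}))"
    by (subst emeasure_distr[OF measurable_vec_lambda]) (auto simp: vimage_vec_lambda_box)
  also have "\<dots> = (\<Prod>i\<in>UNIV. emeasure lborel {l $ i<..<u $ i})"
    by (intro lebPi.emeasure_PiM) auto
  also have "\<dots> = ennreal (\<Prod>i\<in>UNIV. u $ i - l $ i)"
    using le by (simp add: prod_ennreal)
  finally show "emeasure (distr (lebPi UNIV) borel vec_lambda) (box l u) = ennreal (\<Prod>b\<in>Basis. (u - l) \<bullet> b)"
    by (simp add: prod_Basis_cart inner_axis)
qed simp

definition rat_boxes_cart :: "(real^'n) set set" where
  "rat_boxes_cart = {box a b | a b. \<forall>i. a $ i \<in> \<rat> \<and> b $ i \<in> \<rat> \<and> a $ i < b $ i}"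

text \<open>Under \<open>vec_lambda\<close> boxes, their measures and hence their averages
  correspond, so the level set pulls back into the one already estimated. It is open as a union of
  open boxes, hence measurable.\<close>

lemma strong_maximal_weak_type_cart:
  fixes f :: "real^'n \<Rightarrow> ennreal"
  assumes f: "f \<in> borel_measurable borel"
  shows "emeasure lborel {x. 1 < maximal lborel rat_boxes_cart f x}
     \<le> 6 ^ CARD('n) * (\<integral>\<^sup>+x. llog_step CARD('n) (f x) \<partial>lborel)"
proof -
  let ?M = "lebPi (UNIV :: 'n set)" and ?f = "\<lambda>x. f (vec_lambda x)"
  have fm: "?f \<in> borel_measurable ?M" using measurable_compose[OF measurable_vec_lambda f] .
  define E where "E = {x. 1 < maximal lborel rat_boxes_cart f x}"
  have "E = \<Union>{R\<in>rat_boxes_cart. 1 < average lborel R f}"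
    by (auto simp: E_def less_maximal_iff)
  then have "open E" by (auto simp: rat_boxes_cart_def intro!: open_Union)
  then have Em: "E \<in> sets borel" by simp
  have avg: "average lborel (box a b) f = average ?M (PiE UNIV (\<lambda>i. {a $ i<..<b $ i})) ?f" for a b :: "real^'n"
  proof -
    have ind: "indicator (box a b) (vec_lambda y) = (indicator (PiE UNIV (\<lambda>i. {a $ i<..<b $ i})) y :: ennreal)" for y
      by (auto simp: indicator_def mem_box_cart)
    have "(\<integral>\<^sup>+x\<in>box a b. f x \<partial>lborel) = (\<integral>\<^sup>+y\<in>PiE UNIV (\<lambda>i. {a $ i<..<b $ i}). ?f y \<partial>?M)"
      using f by (subst lborel_cart, subst nn_integral_distr[OF measurable_vec_lambda]) (auto simp: ind)
    moreover have "emeasure lborel (box a b) = emeasure ?M (PiE UNIV (\<lambda>i. {a $ i<..<b $ i}))"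
      by (subst lborel_cart, subst emeasure_distr[OF measurable_vec_lambda]) (auto simp: vimage_vec_lambda_box)
    ultimately show ?thesis by (simp add: average_def)
  qed
  have sub: "vec_lambda -` E \<inter> space ?M \<subseteq> {x\<in>space ?M. 1 < maximal ?M (rat_boxes UNIV) ?f x}"
  proof
    fix y assume y: "y \<in> vec_lambda -` E \<inter> space ?M"
    then obtain R where R: "R \<in> rat_boxes_cart" "vec_lambda y \<in> R" "1 < average lborel R f"
      by (auto simp: E_def less_maximal_iff)
    obtain a b where ab: "R = box a b" "\<And>i. a $ i \<in> \<rat> \<and> b $ i \<in> \<rat> \<and> a $ i < b $ i"
      using R(1) by (auto simp: rat_boxes_cart_def)
    let ?J = "\<lambda>i. {a $ i<..<b $ i}"
    have "PiE UNIV ?J \<in> rat_boxes UNIV"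
      unfolding rat_boxes_def using ab(2) by (intro image_eqI[of _ _ ?J]) (auto simp: rat_intervals_def)
    moreover have "y \<in> PiE UNIV ?J" using R(2) ab(1) by (auto simp: mem_box_cart)
    ultimately show "y \<in> {x\<in>space ?M. 1 < maximal ?M (rat_boxes UNIV) ?f x}"
      using y R(3) avg[of a b] ab(1) by (auto simp: less_maximal_iff)
  qed
  have "emeasure lborel E = emeasure ?M (vec_lambda -` E \<inter> space ?M)"
    using Em by (subst lborel_cart, subst emeasure_distr[OF measurable_vec_lambda]) auto
  also have "\<dots> \<le> emeasure ?M {x\<in>space ?M. 1 < maximal ?M (rat_boxes UNIV) ?f x}"
    using sub rat_boxes_measurable[of "UNIV :: 'n set"]
    by (intro emeasure_mono borel_measurable_less maximal_measurable) auto
  also have "\<dots> \<le> 6 ^ CARD('n) * (\<integral>\<^sup>+x. llog_step CARD('n) (?f x) \<partial>?M)"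
    by (intro strong_maximal_weak_type fm) simp
  also have "(\<integral>\<^sup>+x. llog_step CARD('n) (?f x) \<partial>?M) = (\<integral>\<^sup>+x. llog_step CARD('n) (f x) \<partial>lborel)"
    using measurable_compose[OF f llog_step_measurable]
    by (subst lborel_cart, subst nn_integral_distr[OF measurable_vec_lambda]) auto
  finally show ?thesis unfolding E_def .
qed

text \<open>Each endpoint moves outward to a rational point by less than half the side, so every
  side at most doubles.\<close>

lemma rat_box_enlargement:
  fixes a b :: "real^'n"
  assumes "\<And>i. a $ i < b $ i"
  obtains R where "R \<in> rat_boxes_cart" "box a b \<subseteq> R"
    "emeasure lborel R \<le> 2 ^ CARD('n) * emeasure lborel (box a b)"
proof -
  let ?h = "\<lambda>i. (b $ i - a $ i) / 2"
  have "\<exists>q\<in>\<rat>. a $ i - ?h i < q \<and> q < a $ i" for i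
    using Rats_dense_in_real[of "a $ i - ?h i" "a $ i"] assms[of i] by auto
  then obtain c where c: "\<And>i. c i \<in> \<rat> \<and> a $ i - ?h i < c i \<and> c i < a $ i" by metis
  have "\<exists>q\<in>\<rat>. b $ i < q \<and> q < b $ i + ?h i" for i
    using Rats_dense_in_real[of "b $ i" "b $ i + ?h i"] assms[of i] by auto
  then obtain d where d: "\<And>i. d i \<in> \<rat> \<and> b $ i < d i \<and> d i < b $ i + ?h i" by metis
  define R where "R = box (vec_lambda c) (vec_lambda d)"
  have cd: "c i < d i" for i using c[of i] d[of i] assms[of i] by linarith
  have len: "d i - c i \<le> 2 * (b $ i - a $ i)" for i using c[of i] d[of i] by argo
  show ?thesis
  proof (rule that[of R])
    show "R \<in> rat_boxes_cart"
      unfolding R_def rat_boxes_cart_def mem_Collect_eq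
      using c d cd by (intro exI[of _ "vec_lambda c"] exI[of _ "vec_lambda d"]) auto
    show "box a b \<subseteq> R"
    proof
      fix x assume "x \<in> box a b"
      then have "a $ i < x $ i \<and> x $ i < b $ i" for i by (simp add: mem_box_cart)
      then have "c i < x $ i \<and> x $ i < d i" for i using c[of i] d[of i] by (meson less_trans)
      then show "x \<in> R" by (simp add: R_def mem_box_cart)
    qed
    have "emeasure lborel R = ennreal (\<Prod>i\<in>UNIV. d i - c i)"
      unfolding R_def using cd by (subst emeasure_box_cart) (auto simp: less_imp_le)
    also have "\<dots> \<le> ennreal (\<Prod>i\<in>UNIV. 2 * (b $ i - a $ i))"
      using len cd by (intro ennreal_leI prod_mono) (auto simp: less_imp_le)
    also have "\<dots> = ennreal (2 ^ CARD('n)) * ennreal (\<Prod>i\<in>UNIV. b $ i - a $ i)"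
      using assms by (subst prod.distrib, subst ennreal_mult) (auto simp: prod_nonneg less_imp_le)
    also have "\<dots> = 2 ^ CARD('n) * emeasure lborel (box a b)"
      using assms by (subst emeasure_box_cart) (auto simp: less_imp_le ennreal_power[symmetric])
    finally show "emeasure lborel R \<le> 2 ^ CARD('n) * emeasure lborel (box a b)" .
  qed
qed

text \<open>Outside all sets \<open>E i\<close>, the average of the modulus of \<open>f i\<close>
  over a rectangle containing \<open>x\<close> is at most \<open>s * t i\<close>. The product of
  these bounds is at most \<open>s ^ m\<close>, so \<open>x\<close> is not in the level set.\<close>

lemma strong_maximal_level_set_le:
  fixes f :: "nat \<Rightarrow> real^'n \<Rightarrow> complex"
  assumes f: "\<And>i. i \<in> {1..m} \<Longrightarrow> f i \<in> borel_measurable lebesgue"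
    and s: "s > 0" and t: "\<And>i. i \<in> {1..m} \<Longrightarrow> t i > 0" and prod: "(\<Prod>i\<in>{1..m}. t i) \<le> 1"
  shows "emeasure lebesgue {x. strong_maximal m f x > ennreal (s ^ m)}
     \<le> (\<Sum>i\<in>{1..m}. 6 ^ CARD('n) *
          (\<integral>\<^sup>+x. llog_step CARD('n) (ennreal (2 ^ CARD('n) * (cmod (f i x) / s) / t i)) \<partial>lebesgue))"
proof -
  let ?n = "CARD('n)"
  let ?h = "\<lambda>i x. ennreal (2 ^ ?n * (cmod (f i x) / s) / t i)"
  \<comment> \<open>The weak-type bound is for Borel functions, so each Lebesgue measurable
    \<open>?h i\<close> is replaced by a Borel function equal to it almost everywhere; averages do
    not notice.\<close>
  have "\<forall>i\<in>{1..m}. \<exists>g. g \<in> borel_measurable borel \<and> (AE x in lborel. ?h i x = g x)"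
  proof
    fix i assume that: "i \<in> {1..m}"
    have "?h i \<in> borel_measurable lebesgue" using f[OF that] by measurable
    from completion_ex_borel_measurable[OF this]
    show "\<exists>g. g \<in> borel_measurable borel \<and> (AE x in lborel. ?h i x = g x)" by auto
  qed
  from bchoice[OF this] obtain g where "\<forall>i\<in>{1..m}. g i \<in> borel_measurable borel \<and> (AE x in lborel. ?h i x = g i x)"
    by blast
  then have g: "\<And>i. i \<in> {1..m} \<Longrightarrow> g i \<in> borel_measurable borel"
    and g_eq: "\<And>i. i \<in> {1..m} \<Longrightarrow> AE x in lborel. ?h i x = g i x" by blast+
  define E where "E i = {x. 1 < maximal lborel rat_boxes_cart (g i) x}" for i
  have openE: "open (E i)" for i
  proof -
    have "E i = \<Union>{R\<in>rat_boxes_cart. 1 < average lborel R (g i)}"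
      by (auto simp: E_def less_maximal_iff)
    then show ?thesis by (auto simp: rat_boxes_cart_def intro!: open_Union)
  qed
  have sub: "{x. strong_maximal m f x > ennreal (s ^ m)} \<subseteq> (\<Union>i\<in>{1..m}. E i)"
  proof
    fix x assume "x \<in> {x. strong_maximal m f x > ennreal (s ^ m)}"
    then obtain R where R: "R \<in> rectangles" "x \<in> R"
      and gt: "ennreal (s ^ m) < (\<Prod>i\<in>{1..m}. (\<integral>\<^sup>+y\<in>R. ennreal (cmod (f i y)) \<partial>lebesgue) / emeasure lebesgue R)"
      by (auto simp: strong_maximal_def less_SUP_iff)
    obtain a b where ab: "R = box a b" "\<And>i. a $ i < b $ i" using R(1) by (auto simp: rectangles_def)
    obtain R' where R': "R' \<in> rat_boxes_cart" "R \<subseteq> R'" "emeasure lborel R' \<le> 2 ^ ?n * emeasure lborel R"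
      using rat_box_enlargement[of a b] ab by metis
    have R0: "emeasure lborel R \<noteq> 0" "emeasure lborel R \<noteq> \<infinity>"
      using emeasure_box_cart_nontrivial[OF ab(2)] ab(1) by auto
    have R'0: "emeasure lborel R' \<noteq> 0" "emeasure lborel R' \<noteq> \<infinity>"
    proof -
      obtain c d :: "real^'n" where cd: "R' = box c d" "\<And>i. c $ i < d $ i" using R'(1) by (auto simp: rat_boxes_cart_def)
      then show "emeasure lborel R' \<noteq> 0" "emeasure lborel R' \<noteq> \<infinity>"
        using emeasure_box_cart_nontrivial[OF cd(2)] by auto
    qed
    show "x \<in> (\<Union>i\<in>{1..m}. E i)"
    proof (rule ccontr)
      assume "x \<notin> (\<Union>i\<in>{1..m}. E i)"
      then have le1: "average lborel R' (g i) \<le> 1" if "i \<in> {1..m}" for i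
        using that R'(1,2) R(2) by (auto simp: E_def less_maximal_iff not_less)
      have avg: "(\<integral>\<^sup>+y\<in>R. ennreal (cmod (f i y)) \<partial>lebesgue) / emeasure lebesgue R \<le> ennreal (s * t i)"
        if i: "i \<in> {1..m}" for i
      proof -
        have Rb: "R \<in> sets borel" using ab by simp
        have scale: "ennreal (cmod (f i y)) = ennreal (s * t i / 2 ^ ?n) * ?h i y" for y
          using s t[OF i] by (subst ennreal_mult[symmetric]) auto
        have "(\<integral>\<^sup>+y\<in>R. ennreal (cmod (f i y)) \<partial>lebesgue) = (\<integral>\<^sup>+y\<in>R. ennreal (cmod (f i y)) \<partial>lborel)"
          by (rule nn_integral_completion)
        also have "\<dots> = (\<integral>\<^sup>+y. ennreal (s * t i / 2 ^ ?n) * (g i y * indicator R y) \<partial>lborel)"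
          using g_eq[OF i] by (intro nn_integral_cong_AE) (auto simp: scale mult.assoc)
        also have "\<dots> = ennreal (s * t i / 2 ^ ?n) * (\<integral>\<^sup>+y\<in>R. g i y \<partial>lborel)"
          using g[OF i] Rb by (intro nn_integral_cmult) auto
        also have "\<dots> \<le> ennreal (s * t i / 2 ^ ?n) * (\<integral>\<^sup>+y\<in>R'. g i y \<partial>lborel)"
          using R'(2) by (intro mult_left_mono nn_integral_mono) (auto simp: indicator_def)
        also have "(\<integral>\<^sup>+y\<in>R'. g i y \<partial>lborel) = emeasure lborel R' * average lborel R' (g i)"
          using emeasure_times_average[OF R'0] by simp
        \<comment> \<open>The loss \<open>2 ^ ?n\<close> from passing to the rational box
          \<open>R'\<close> is absorbed by the factor \<open>2 ^ ?n\<close> built into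
          \<open>?h\<close>.\<close>
        also have "ennreal (s * t i / 2 ^ ?n) * (emeasure lborel R' * average lborel R' (g i))
             \<le> ennreal (s * t i / 2 ^ ?n) * ((2 ^ ?n * emeasure lborel R) * 1)"
          using R'(3) le1[OF i] by (intro mult_left_mono mult_mono) auto
        also have "\<dots> = ennreal (s * t i / 2 ^ ?n) * ennreal (2 ^ ?n) * emeasure lborel R"
          by (simp add: mult.assoc ennreal_power[symmetric])
        also have "ennreal (s * t i / 2 ^ ?n) * ennreal (2 ^ ?n) = ennreal (s * t i)"
          using s t[OF i] by (subst ennreal_mult[symmetric]) auto
        finally have "(\<integral>\<^sup>+y\<in>R. ennreal (cmod (f i y)) \<partial>lebesgue) / emeasure lborel R
            \<le> (ennreal (s * t i) * emeasure lborel R) / emeasure lborel R"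
          by (rule divide_right_mono_ennreal)
        also have "\<dots> = ennreal (s * t i)" using R0 by (simp add: ennreal_mult_divide_eq)
        finally show ?thesis using Rb by simp
      qed
      have "(\<Prod>i\<in>{1..m}. (\<integral>\<^sup>+y\<in>R. ennreal (cmod (f i y)) \<partial>lebesgue) / emeasure lebesgue R)
          \<le> (\<Prod>i\<in>{1..m}. ennreal (s * t i))"
        using avg by (rule prod_mono_ennreal)
      also have "\<dots> = ennreal (s ^ m * (\<Prod>i\<in>{1..m}. t i))"
        using s t by (subst prod_ennreal) (auto simp: prod.distrib less_imp_le)
      also have "\<dots> \<le> ennreal (s ^ m)"
        using prod s by (intro ennreal_leI mult_left_le) auto
      finally show False using gt by simp
    qed
  qed
  have "emeasure lebesgue {x. strong_maximal m f x > ennreal (s ^ m)} \<le> emeasure lebesgue (\<Union>i\<in>{1..m}. E i)"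
    using sub openE by (intro emeasure_mono) (auto intro!: lborelD borel_open open_UN)
  also have "\<dots> \<le> (\<Sum>i\<in>{1..m}. emeasure lebesgue (E i))"
    using openE by (intro emeasure_subadditive_finite) (auto intro!: lborelD borel_open)
  also have "\<dots> \<le> (\<Sum>i\<in>{1..m}. 6 ^ ?n * (\<integral>\<^sup>+x. llog_step ?n (?h i x) \<partial>lebesgue))"
  proof (rule sum_mono)
    fix i assume i: "i \<in> {1..m}"
    have "emeasure lebesgue (E i) = emeasure lborel (E i)" using openE by simp
    also have "\<dots> \<le> 6 ^ ?n * (\<integral>\<^sup>+x. llog_step ?n (g i x) \<partial>lborel)"
      unfolding E_def by (rule strong_maximal_weak_type_cart[OF g[OF i]])
    also have "(\<integral>\<^sup>+x. llog_step ?n (g i x) \<partial>lborel) = (\<integral>\<^sup>+x. llog_step ?n (?h i x) \<partial>lebesgue)"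
      unfolding nn_integral_completion using g_eq[OF i] by (intro nn_integral_cong_AE) auto
    finally show "emeasure lebesgue (E i) \<le> 6 ^ ?n * (\<integral>\<^sup>+x. llog_step ?n (?h i x) \<partial>lebesgue)" .
  qed
  finally show ?thesis .
qed

section \<open>The upper bound\<close>

text \<open>A dilation that is good for every component but becomes bad for each of them when halved
  must have product at most 1, otherwise it would contradict the critical estimate.\<close>

lemma dilation_selection:
  fixes F :: "'a \<Rightarrow> real \<Rightarrow> ennreal"
  assumes I: "finite I"
    and ex: "\<And>i. i \<in> I \<Longrightarrow> \<exists>t>0. F i t \<le> \<alpha>"
    and crit: "\<And>t. (\<forall>i\<in>I. t i > 0) \<Longrightarrow> (\<Prod>i\<in>I. t i) \<ge> 1 \<Longrightarrow> (\<Prod>i\<in>I. F i (t i / 2)) < \<alpha> ^ card I"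
  shows "\<exists>t. (\<forall>i\<in>I. t i > 0 \<and> F i (t i) \<le> \<alpha>) \<and> (\<Prod>i\<in>I. t i) \<le> 1"
proof (rule ccontr)
  assume "\<not> ?thesis"
  then have neg: "(\<Prod>i\<in>I. t i) > 1" if "\<forall>i\<in>I. t i > 0 \<and> F i (t i) \<le> \<alpha>" for t
    using that not_le by blast
  have "\<forall>i\<in>I. \<exists>t. t > 0 \<and> F i t \<le> \<alpha>" using ex by blast
  from bchoice[OF this] obtain e where e: "\<forall>i\<in>I. e i > 0 \<and> F i (e i) \<le> \<alpha>" by blast
  \<comment> \<open>If every admissible dilation of some coordinate stayed admissible when halved,
    that coordinate could be made arbitrarily small with the others fixed, and the product would
    drop below 1 against \<open>neg\<close>.\<close>
  have "\<forall>i\<in>I. \<exists>t. t > 0 \<and> F i t \<le> \<alpha> \<and> \<not> F i (t / 2) \<le> \<alpha>"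
  proof (intro ballI, rule ccontr)
    fix i assume i: "i \<in> I" and "\<not> (\<exists>t. t > 0 \<and> F i t \<le> \<alpha> \<and> \<not> F i (t / 2) \<le> \<alpha>)"
    then have halve: "F i (t / 2) \<le> \<alpha>" if "t > 0" "F i t \<le> \<alpha>" for t using that by blast
    have small: "F i (e i / 2 ^ p) \<le> \<alpha>" for p
    proof (induction p)
      case (Suc p)
      then show ?case using halve[of "e i / 2 ^ p"] e i by (simp add: field_simps)
    qed (use e i in simp)
    obtain p :: nat where p: "(\<Prod>i\<in>I. e i) < 2 ^ p" using real_arch_pow[of 2] by auto
    let ?t = "e(i := e i / 2 ^ p)"
    have "\<forall>j\<in>I. ?t j > 0 \<and> F j (?t j) \<le> \<alpha>" using e i small by simp
    then have "(\<Prod>j\<in>I. ?t j) > 1" by (rule neg)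
    moreover have "(\<Prod>j\<in>I. ?t j) = (\<Prod>j\<in>I. e j) / 2 ^ p"
      using I i by (simp add: prod.remove[of I i])
    ultimately show False using p by (simp add: less_divide_eq)
  qed
  from bchoice[OF this] obtain t where t: "\<forall>i\<in>I. t i > 0 \<and> F i (t i) \<le> \<alpha> \<and> \<not> F i (t i / 2) \<le> \<alpha>"
    by blast
  then have "(\<Prod>i\<in>I. t i) > 1" using neg by blast
  then have "(\<Prod>i\<in>I. F i (t i / 2)) < \<alpha> ^ card I" using t by (intro crit) auto
  moreover have "\<alpha> ^ card I \<le> (\<Prod>i\<in>I. F i (t i / 2))"
    using prod_mono_ennreal[of I "\<lambda>_. \<alpha>" "\<lambda>i. F i (t i / 2)"] t by (auto simp: not_le less_imp_le)
  ultimately show False by simp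
qed

text \<open>Restrictions to the balls \<open>cball 0 k\<close> are integrable and converge pointwise
  to \<open>f\<close>.\<close>

lemma locally_integrable_measurable:
  assumes "locally_integrable (f :: real^'n \<Rightarrow> complex)"
  shows "f \<in> borel_measurable lebesgue"
proof (rule borel_measurable_LIMSEQ_metric)
  fix k :: nat
  have "set_integrable lebesgue (cball 0 (real k)) f"
    using assms by (auto simp: locally_integrable_def)
  then show "(\<lambda>x. indicator (cball 0 (real k)) x *\<^sub>R f x) \<in> borel_measurable lebesgue"
    unfolding set_integrable_def by (rule borel_measurable_integrable)
next
  fix x :: "real^'n"
  have "\<forall>\<^sub>F k in sequentially. norm x \<le> real k"
    using eventually_ge_at_top[of "nat \<lceil>norm x\<rceil>"] by eventually_elim linarith
  then have "\<forall>\<^sub>F k in sequentially. indicator (cball 0 (real k)) x *\<^sub>R f x = f x"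
    by eventually_elim simp
  then show "(\<lambda>k. indicator (cball 0 (real k)) x *\<^sub>R f x) \<longlonglongrightarrow> f x"
    by (rule tendsto_eventually)
qed

lemma Phi_measurable[measurable]: "Phi n \<in> borel_measurable borel"
  unfolding Phi_def[abs_def] log_plus_def[abs_def] by measurable

lemma Phi_iter_measurable[measurable]: "(Phi n ^^ k) \<in> borel_measurable borel"
proof (induction k)
  case (Suc k)
  then show ?case using measurable_comp[OF Suc Phi_measurable] by simp
qed simp

lemma dilation_weight_le: "t \<ge> 1 \<Longrightarrow> dilation_weight m n t \<le> 1 / t"
  using one_le_power[of "one_log t" "(m - 1) * (n - 1)"] log_plus_nonneg[of t]
    mult_left_mono[of 1 "one_log t ^ ((m - 1) * (n - 1))" t]
  by (simp add: dilation_weight_def frac_le)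

text \<open>This settles the case in which an integral on the right vanishes, including the product
  of 0 and infinity: the level set is then empty.\<close>

lemma strong_maximal_eq_0:
  assumes i: "i \<in> {1..m}" and zero: "(\<integral>\<^sup>+x. ennreal (cmod (f i x)) \<partial>lebesgue) = 0"
  shows "strong_maximal m f x = 0"
proof -
  have "(\<integral>\<^sup>+y\<in>R. ennreal (cmod (f i y)) \<partial>lebesgue) = 0" for R
  proof -
    have "(\<integral>\<^sup>+y\<in>R. ennreal (cmod (f i y)) \<partial>lebesgue) \<le> (\<integral>\<^sup>+x. ennreal (cmod (f i x)) \<partial>lebesgue)"
      by (intro nn_integral_mono) (auto simp: indicator_def)
    then show ?thesis using zero by simp
  qed
  then have prod0: "(\<Prod>i\<in>{1..m}. (\<integral>\<^sup>+y\<in>R. ennreal (cmod (f i y)) \<partial>lebesgue) / emeasure lebesgue R) = 0" for R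
    using i by (intro prod_zero bexI[of _ i]) auto
  have "strong_maximal m f x \<le> 0"
    unfolding strong_maximal_def by (intro SUP_least) (simp only: prod0)
  then show ?thesis by simp
qed

text \<open>\<open>dilation_selection\<close> at a threshold \<open>a\<close> proportional to the
  right-hand side yields admissible \<open>t i\<close> with product at most 1; summing the
  \<open>m\<close> level set bounds gives \<open>m * 6 ^ ?n * a\<close>.\<close>

lemma distributional_estimate_m:
  assumes m: "m \<ge> 1"
  shows "\<exists>C>0. \<forall>s>0. \<forall>f :: nat \<Rightarrow> real^'n \<Rightarrow> complex.
      (\<forall>i\<in>{1..m}. locally_integrable (f i)) \<longrightarrow> distributional_estimate C m m s f"
proof -
  let ?n = "CARD('n)"
  have n: "?n \<ge> 1" by (simp add: Suc_le_eq)
  obtain C1 where C1: "C1 > 0" and step: "\<And>t u. t > 0 \<Longrightarrow> u \<ge> 0 \<Longrightarrow>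
      llog_step ?n (ennreal (2 ^ (?n + 1) * u / t)) \<le> ennreal (C1 * dilation_weight m ?n t * (Phi ?n ^^ m) u)"
    using llog_step_le_dilation[OF n m] by blast
  \<comment> \<open>Twice the constant of the critical estimate, because
    \<open>dilation_selection\<close> asks for a strict inequality.\<close>
  define K where "K = 2 * (C1 ^ m * real m ^ ((m - 1) * (?n - 1)))"
  have K: "K > 0" using C1 m by (simp add: K_def)
  define C where "C = real m * 6 ^ ?n * root m K"
  have C: "C > 0" using K m by (simp add: C_def)
  show ?thesis
  proof (intro exI[of _ C] conjI allI impI C)
    fix s :: real and f :: "nat \<Rightarrow> real^'n \<Rightarrow> complex"
    assume s: "s > 0" and "\<forall>i\<in>{1..m}. locally_integrable (f i)"
    then have f: "f i \<in> borel_measurable lebesgue" if "i \<in> {1..m}" for i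
      using that locally_integrable_measurable by blast
    define w where "w i x = cmod (f i x) / s" for i x
    have w0: "w i x \<ge> 0" for i x using s by (simp add: w_def)
    have wm: "w i \<in> borel_measurable lebesgue" if "i \<in> {1..m}" for i
      unfolding w_def using f[OF that] by measurable
    define B where "B i = (\<integral>\<^sup>+x. ennreal ((Phi ?n ^^ m) (w i x)) \<partial>lebesgue)" for i
    define P where "P = (\<Prod>i\<in>{1..m}. B i)"
    let ?S = "{x. strong_maximal m f x > ennreal (s ^ m)}"
    have "emeasure lebesgue ?S \<le> ennreal C * ennroot m P"
    \<comment> \<open>In the remaining case every \<open>B i\<close> is positive and
      \<open>P\<close> is finite, so every \<open>B i\<close> is finite too.\<close>
    proof (cases "P = top \<or> (\<exists>i\<in>{1..m}. B i = 0)")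
      case True
      then show ?thesis
      proof
        assume "P = top"
        then show ?thesis using C by (simp add: ennroot_def ennreal_mult_top)
      next
        assume "\<exists>i\<in>{1..m}. B i = 0"
        then obtain i where i: "i \<in> {1..m}" "B i = 0" by blast
        have "(\<integral>\<^sup>+x. ennreal (cmod (f i x)) \<partial>lebesgue) = (\<integral>\<^sup>+x. ennreal s * ennreal (w i x) \<partial>lebesgue)"
          using s by (intro nn_integral_cong) (simp add: w_def ennreal_mult[symmetric])
        also have "\<dots> = ennreal s * (\<integral>\<^sup>+x. ennreal (w i x) \<partial>lebesgue)"
          using wm[OF i(1)] by (intro nn_integral_cmult) measurable
        also have "\<dots> \<le> ennreal s * B i"
          unfolding B_def using w0 by (intro mult_left_mono nn_integral_mono ennreal_leI Phi_iter_ge_self) auto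
        finally have "strong_maximal m f x = 0" for x
          using i by (intro strong_maximal_eq_0[of i]) auto
        then show ?thesis by simp
      qed
    next
      case False
      have B0: "B i \<noteq> 0" if "i \<in> {1..m}" for i using False that by blast
      have Btop: "B i \<noteq> top" if "i \<in> {1..m}" for i
        using False B0 that ennreal_prod_eq_top[of B "{1..m}"] unfolding P_def by auto
      define p where "p = enn2real P"
      have P: "P = ennreal p" using False by (simp add: p_def less_top)
      have "P \<noteq> 0" unfolding P_def using B0 by simp
      then have p: "p > 0" using P by (cases "p > 0") (auto simp: not_less ennreal_neg)
      define a where "a = root m (K * p)"
      have a: "a > 0" using K p m by (simp add: a_def)
      have am: "a ^ m = K * p" using K p m by (simp add: a_def)
      define F where "F i t = (\<integral>\<^sup>+x. llog_step ?n (ennreal (2 ^ ?n * w i x / t)) \<partial>lebesgue)" for i t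
      have half: "F i (t / 2) \<le> ennreal (C1 * dilation_weight m ?n t) * B i" if "i \<in> {1..m}" "t > 0" for i t
      proof -
        have "F i (t / 2) \<le> (\<integral>\<^sup>+x. ennreal (C1 * dilation_weight m ?n t) * ennreal ((Phi ?n ^^ m) (w i x)) \<partial>lebesgue)"
          unfolding F_def
        proof (rule nn_integral_mono)
          fix x
          have eq: "2 ^ ?n * w i x / (t / 2) = 2 ^ (?n + 1) * w i x / t" by simp
          have "(Phi ?n ^^ m) (w i x) \<ge> 0"
            using Phi_iter_ge_self[OF w0[of i x], where n="?n" and k=m] w0[of i x] by simp
          then show "llog_step ?n (ennreal (2 ^ ?n * w i x / (t / 2)))
             \<le> ennreal (C1 * dilation_weight m ?n t) * ennreal ((Phi ?n ^^ m) (w i x))"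
            using step[OF that(2) w0[of i x]] C1 dilation_weight_nonneg[OF that(2), of m ?n]
            unfolding eq by (simp add: ennreal_mult)
        qed
        also have "\<dots> = ennreal (C1 * dilation_weight m ?n t) * B i"
          unfolding B_def using wm[OF that(1)] by (intro nn_integral_cmult) measurable
        finally show ?thesis .
      qed
      \<comment> \<open>The weight is at most \<open>1 / t\<close> for large \<open>t\<close>, so a
        sufficiently strong dilation brings the integral below \<open>a\<close>; finiteness of
        \<open>B i\<close> enters here.\<close>
      have ex: "\<exists>t>0. F i t \<le> ennreal a" if i: "i \<in> {1..m}" for i
      proof -
        define b where "b = enn2real (B i)"
        have b: "B i = ennreal b" "b \<ge> 0" using Btop[OF i] by (simp_all add: b_def less_top)
        define t where "t = max 1 (C1 * b / a)"
        have t: "t \<ge> 1" "C1 * b / a \<le> t" by (auto simp: t_def)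
        have "F i (t / 2) \<le> ennreal (C1 * dilation_weight m ?n t) * B i" using t i by (intro half) auto
        also have "\<dots> \<le> ennreal (C1 * (1 / t)) * B i"
          using dilation_weight_le[OF t(1), of m ?n] C1 by (intro mult_right_mono ennreal_leI mult_left_mono) auto
        also have "\<dots> = ennreal (C1 * b / t)"
          unfolding b(1) using C1 t b(2) by (subst ennreal_mult[symmetric]) auto
        also have "\<dots> \<le> ennreal a"
          using t a by (intro ennreal_leI) (simp add: divide_le_eq mult.commute)
        finally show ?thesis using t by (intro exI[of _ "t / 2"]) auto
      qed
      have crit: "(\<Prod>i\<in>{1..m}. F i (t i / 2)) < ennreal a ^ card {1..m}"
        if t: "\<forall>i\<in>{1..m}. t i > 0" "(\<Prod>i\<in>{1..m}. t i) \<ge> 1" for t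
      proof -
        let ?c = "card {1..m}"
        have c: "?c = m" by simp
        have dw: "(\<Prod>i\<in>{1..m}. dilation_weight m ?n (t i)) \<le> real m ^ ((m - 1) * (?n - 1))"
          using prod_dilation_weight_le[of "{1..m}" t ?n] t m unfolding c by auto
        have "(\<Prod>i\<in>{1..m}. F i (t i / 2)) \<le> (\<Prod>i\<in>{1..m}. ennreal (C1 * dilation_weight m ?n (t i)) * B i)"
          using t half by (intro prod_mono_ennreal) auto
        also have "\<dots> = ennreal (\<Prod>i\<in>{1..m}. C1 * dilation_weight m ?n (t i)) * P"
          unfolding prod.distrib[of "\<lambda>i. ennreal (C1 * dilation_weight m ?n (t i))"] P_def
          using C1 t dilation_weight_nonneg by (subst prod_ennreal) auto
        also have "(\<Prod>i\<in>{1..m}. C1 * dilation_weight m ?n (t i)) = C1 ^ m * (\<Prod>i\<in>{1..m}. dilation_weight m ?n (t i))"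
          by (simp add: prod.distrib)
        also have "ennreal (C1 ^ m * (\<Prod>i\<in>{1..m}. dilation_weight m ?n (t i))) * P \<le> ennreal (K / 2) * P"
          using dw C1 by (intro mult_right_mono ennreal_leI) (auto simp: K_def)
        also have "\<dots> = ennreal (K / 2 * p)" unfolding P using K p by (subst ennreal_mult) auto
        also have "\<dots> < ennreal (K * p)" using K p by (intro ennreal_lessI) auto
        also have "\<dots> = ennreal a ^ ?c" using a am by (simp add: ennreal_power)
        finally show ?thesis .
      qed
      obtain t where t: "\<forall>i\<in>{1..m}. t i > 0 \<and> F i (t i) \<le> ennreal a" and prod: "(\<Prod>i\<in>{1..m}. t i) \<le> 1"
        using dilation_selection[of "{1..m}" F "ennreal a"] ex crit by auto
      have "emeasure lebesgue ?S \<le> (\<Sum>i\<in>{1..m}. 6 ^ ?n * F i (t i))"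
        unfolding F_def w_def using strong_maximal_level_set_le[OF f s _ prod] t by auto
      also have "\<dots> \<le> (\<Sum>i\<in>{1..m}. 6 ^ ?n * ennreal a)"
        using t by (intro sum_mono mult_left_mono) auto
      also have "\<dots> = ennreal (real m * 6 ^ ?n * a)"
        using a by (simp add: ennreal_mult ennreal_of_nat_eq_real_of_nat ennreal_power[symmetric] mult.assoc)
      also have "\<dots> = ennreal C * ennroot m P"
        unfolding P using p m C ennreal_mult[of C "root m p"] real_root_gt_zero[of m p]
        by (simp add: ennroot_def a_def C_def real_root_mult mult.assoc)
      finally show ?thesis .
    qed
    then show "distributional_estimate C m m s f"
      unfolding distributional_estimate_def P_def B_def w_def .
  qed
qed

section \<open>Sharpness\<close>

lemma Phi_iter_0: "(Phi n ^^ k) 0 = 0"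
  by (induction k) (auto simp: Phi_def)

text \<open>1 is a fixed point because \<open>log_plus 1 = 0\<close> and the exponent
  \<open>n - 1\<close> is positive; for \<open>n = 1\<close> the convention \<open>0 ^ 0 = 1\<close>
  would give the value 2.\<close>

lemma Phi_iter_1: "n \<ge> 2 \<Longrightarrow> (Phi n ^^ k) 1 = 1"
  by (induction k) (auto simp: Phi_def log_plus_def)

lemma emeasure_unit_box: "emeasure lborel (box 0 1 :: (real^'n) set) = 1"
  by (subst emeasure_box_cart) auto

text \<open>All the height sits in one component. On the unit cube the others equal 1, a fixed point
  of the iterates in dimension at least 2, so the product of the \<open>m\<close> integrals is a
  single value of the iterate at \<open>N\<close>.\<close>

definition test_functions :: "real \<Rightarrow> nat \<Rightarrow> real^'n \<Rightarrow> complex" where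
  "test_functions N i x = complex_of_real ((if i = 1 then N else 1) * indicator (box 0 1) x)"

lemma locally_integrable_test_functions: "locally_integrable (test_functions N i :: real^'n \<Rightarrow> complex)"
  unfolding locally_integrable_def
proof (intro allI impI)
  fix K :: "(real^'n) set" assume "compact K"
  then have K: "K \<in> sets borel" by (simp add: borel_compact)
  let ?Q = "box 0 1 :: (real^'n) set" and ?c = "complex_of_real (if i = 1 then N else 1)"
  have "emeasure lebesgue (K \<inter> ?Q) \<le> emeasure lebesgue ?Q" by (intro emeasure_mono) auto
  then have "emeasure lebesgue (K \<inter> ?Q) < \<infinity>" by (simp add: emeasure_unit_box order_le_less_trans)
  then have "integrable lebesgue (indicator (K \<inter> ?Q) :: _ \<Rightarrow> real)"
    using K by (intro integrable_real_indicator) auto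
  then have "integrable lebesgue (\<lambda>x. indicator (K \<inter> ?Q) x *\<^sub>R ?c)"
    by (rule integrable_scaleR_left)
  moreover have "(\<lambda>x. indicator (K \<inter> ?Q) x *\<^sub>R ?c) = (\<lambda>x. indicator K x *\<^sub>R test_functions N i x)"
    by (auto simp: test_functions_def indicator_def scaleR_conv_of_real)
  ultimately show "set_integrable lebesgue K (test_functions N i)"
    unfolding set_integrable_def by simp
qed

text \<open>Used twice: with the identity over a box \<open>R\<close>, for the averages, and with
  the iterate of \<open>Phi\<close> over the whole space, for the right-hand side.\<close>

lemma test_functions_integral:
  assumes N: "N \<ge> 0" and \<phi>: "\<phi> 0 = 0" and R: "box 0 1 \<subseteq> R"
  shows "(\<integral>\<^sup>+x\<in>R. ennreal (\<phi> (cmod (test_functions N i x :: complex))) \<partial>(lebesgue :: (real^'n) measure))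
     = ennreal (\<phi> (if i = 1 then N else 1))"
proof -
  have "(\<integral>\<^sup>+x\<in>R. ennreal (\<phi> (cmod (test_functions N i x :: complex))) \<partial>(lebesgue :: (real^'n) measure))
    = (\<integral>\<^sup>+x. ennreal (\<phi> (if i = 1 then N else 1)) * indicator (box 0 1) x \<partial>(lebesgue :: (real^'n) measure))"
    using N R \<phi> by (intro nn_integral_cong) (auto simp: test_functions_def indicator_def norm_mult)
  then show ?thesis by (simp add: nn_integral_cmult_indicator emeasure_unit_box)
qed

lemma prod_test: "m \<ge> 1 \<Longrightarrow> (\<Prod>i\<in>{1..m}. if i = 1 then a else (b::real)) = a * b ^ (m - 1)"
proof -
  assume m: "m \<ge> 1"
  have "(\<Prod>i\<in>{1..m} - {1}. if i = 1 then a else b) = (\<Prod>i\<in>{1..m} - {1}. b)" by (intro prod.cong) auto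
  then show ?thesis using m by (subst prod.remove[of "{1..m}" 1]) auto
qed

text \<open>The box from the origin with sides \<open>2 ^ (j i + 1)\<close> contains
  \<open>x\<close> and the unit cube and has volume \<open>A\<close>. The product of averages over
  it is \<open>N / A ^ m = 2\<close>; the factor 2 in \<open>N\<close> makes the inequality
  strict.\<close>

lemma strong_maximal_test_functions:
  fixes j :: "'n::finite \<Rightarrow> nat" and x :: "real^'n"
  assumes m: "m \<ge> 1" and x: "\<And>i. 0 < x $ i \<and> x $ i < 2 ^ (j i + 1)"
    and N: "N = 2 * (2 ^ ((\<Sum>i\<in>UNIV. j i) + CARD('n))) ^ m"
  shows "strong_maximal m (test_functions N) x > 1"
proof -
  define A :: real where "A = 2 ^ ((\<Sum>i\<in>UNIV. j i) + CARD('n))"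
  have A: "A > 0" and N0: "N > 0" by (simp_all add: A_def N)
  define R :: "(real^'n) set" where "R = box 0 (\<chi> i. 2 ^ (j i + 1))"
  have "R \<in> rectangles" unfolding R_def rectangles_def mem_Collect_eq
    by (intro exI[of _ 0] exI[of _ "\<chi> i. 2 ^ (j i + 1)"]) simp
  moreover have "x \<in> R" using x by (simp add: R_def mem_box_cart)
  moreover have "emeasure lebesgue R = ennreal A"
  proof -
    have "emeasure lebesgue R = emeasure lborel R" by (simp add: R_def)
    also have "\<dots> = ennreal (\<Prod>i\<in>UNIV. 2 ^ (j i + 1))"
      unfolding R_def by (subst emeasure_box_cart) auto
    also have "(\<Prod>i\<in>UNIV. 2 ^ (j i + 1)) = A"
      unfolding A_def power_sum[symmetric] sum.distrib by simp
    finally show ?thesis .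
  qed
  moreover have QR: "box 0 1 \<subseteq> R"
  proof
    fix y :: "real^'n" assume y: "y \<in> box 0 1"
    have "y $ i < 2 ^ (j i + 1)" for i
      using y one_le_power[of "2::real" "j i + 1"] less_le_trans[of "y $ i" 1 "2 ^ (j i + 1)"] by (simp add: mem_box_cart)
    then show "y \<in> R" using y by (simp add: R_def mem_box_cart)
  qed
  ultimately have "(\<Prod>i\<in>{1..m}. ennreal (if i = 1 then N else 1) / ennreal A) \<le> strong_maximal m (test_functions N) x"
    unfolding strong_maximal_def
    using test_functions_integral[where \<phi>="\<lambda>u. u" and N=N, OF _ _ QR] N0 by (intro SUP_upper2[of R]) auto
  moreover have "(\<Prod>i\<in>{1..m}. ennreal (if i = 1 then N else 1) / ennreal A) = ennreal 2"
  proof -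
    have "(\<Prod>i\<in>{1..m}. ennreal (if i = 1 then N else 1) / ennreal A) = (\<Prod>i\<in>{1..m}. ennreal ((if i = 1 then N else 1) / A))"
      using N0 A by (intro prod.cong divide_ennreal) auto
    also have "\<dots> = ennreal (\<Prod>i\<in>{1..m}. (if i = 1 then N else 1) / A)"
      using N0 A by (intro prod_ennreal) auto
    also have "(\<Prod>i\<in>{1..m}. (if i = 1 then N else 1) / A) = N / A ^ m"
      using m by (simp add: prod_dividef prod_test)
    also have "\<dots> = 2" using A unfolding N A_def[symmetric] by simp
    finally show ?thesis .
  qed
  moreover have "(1::ennreal) < ennreal 2" by (simp add: one_less_numeral)
  ultimately show ?thesis by (metis less_le_trans)
qed

lemma open_strong_maximal: "open {x. strong_maximal m f x > c}"
proof -
  have "{x. strong_maximal m f x > c} = \<Union>{R\<in>rectangles.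
      c < (\<Prod>i\<in>{1..m}. (\<integral>\<^sup>+y\<in>R. ennreal (cmod (f i y)) \<partial>lebesgue) / emeasure lebesgue R)}"
    by (auto simp: strong_maximal_def less_SUP_iff)
  then show ?thesis by (auto simp: rectangles_def intro!: open_Union)
qed

text \<open>The level set contains the region where all coordinates exceed 1 and their product is less
  than \<open>2 ^ (J + n)\<close>; the dyadic boxes with side lengths \<open>2 ^ j i\<close>, \<open>\<Sum>i. j i = J\<close>, are disjoint
  there, and the exponents \<open>j i \<le> q\<close> are free in all coordinates but one.\<close>

lemma strong_maximal_test_functions_large:
  assumes m: "m \<ge> 1" and J: "J = (CARD('n) - 1) * q"
    and N: "N = 2 * (2 ^ (J + CARD('n))) ^ m"
  shows "ennreal (real (q + 1) ^ (CARD('n) - 1) * 2 ^ J)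
     \<le> emeasure lebesgue {x. strong_maximal m (test_functions N :: nat \<Rightarrow> real^'n \<Rightarrow> complex) x > 1}"
proof -
  obtain i0 :: 'n where True by simp
  define G where "G = PiE (UNIV - {i0}) (\<lambda>_::'n. {..q})"
  have fG: "finite G" unfolding G_def by (intro finite_PiE) auto
  have cG: "card G = (q + 1) ^ (CARD('n) - 1)"
    unfolding G_def by (subst card_PiE) auto
  \<comment> \<open>The coordinate \<open>i0\<close> receives the exponent that makes the sum
    \<open>J\<close>. The natural subtraction is exact, as the other exponents sum to at most
    \<open>(CARD('n) - 1) * q = J\<close>.\<close>
  define j where "j g i = (if i = i0 then J - (\<Sum>i\<in>UNIV - {i0}. g i) else g i)" for g :: "'n \<Rightarrow> nat" and i
  have sum_j: "(\<Sum>i\<in>UNIV. j g i) = J" if "g \<in> G" for g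
  proof -
    have "(\<Sum>i\<in>UNIV - {i0}. g i) \<le> (\<Sum>i\<in>UNIV - {i0}. q)"
      using that by (intro sum_mono) (auto simp: G_def PiE_iff)
    also have "\<dots> = J" by (simp add: J)
    finally have "(\<Sum>i\<in>UNIV - {i0}. g i) \<le> J" .
    moreover have "(\<Sum>i\<in>UNIV. j g i) = j g i0 + (\<Sum>i\<in>UNIV - {i0}. j g i)"
      by (simp add: sum.remove[of UNIV i0])
    moreover have "(\<Sum>i\<in>UNIV - {i0}. j g i) = (\<Sum>i\<in>UNIV - {i0}. g i)"
      by (intro sum.cong) (auto simp: j_def)
    ultimately show ?thesis by (simp add: j_def)
  qed
  define D :: "('n \<Rightarrow> nat) \<Rightarrow> (real^'n) set"
    where "D g = box (\<chi> i. 2 ^ j g i) (\<chi> i. 2 ^ (j g i + 1))" for g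
  have emD: "emeasure lborel (D g) = ennreal (2 ^ J)" if "g \<in> G" for g
    unfolding D_def using sum_j[OF that] by (subst emeasure_box_cart) (auto simp: power_sum)
  have disj: "disjoint_family_on D G"
    unfolding disjoint_family_on_def
  proof (intro ballI impI, rule ccontr)
    fix g h assume gh: "g \<in> G" "h \<in> G" "g \<noteq> h" and "D g \<inter> D h \<noteq> {}"
    then obtain x where x: "x \<in> D g" "x \<in> D h" by blast
    \<comment> \<open>Members of \<open>G\<close> are extensional off \<open>i0\<close>, so distinct
      ones differ at a free coordinate; there two dyadic intervals meet only if their exponents
      agree.\<close>
    obtain i where i: "i \<noteq> i0" "g i \<noteq> h i"
      using gh unfolding G_def by (metis PiE_ext Diff_iff singletonD UNIV_I insertI1)
    have lt: "(2::real) ^ g i < 2 ^ (h i + 1)" "(2::real) ^ h i < 2 ^ (g i + 1)"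
      using x i unfolding D_def mem_box_cart j_def by (auto dest!: spec[of _ i])
    then have "g i < h i + 1" "h i < g i + 1"
      by (simp_all only: power_strict_increasing_iff one_less_numeral_iff semiring_norm)
    then show False using i by simp
  qed
  let ?E = "{x. strong_maximal m (test_functions N :: nat \<Rightarrow> real^'n \<Rightarrow> complex) x > 1}"
  have openE: "open ?E" by (rule open_strong_maximal)
  have sub: "(\<Union>g\<in>G. D g) \<subseteq> ?E"
  proof
    fix x assume "x \<in> (\<Union>g\<in>G. D g)"
    then obtain g where g: "g \<in> G" "x \<in> D g" by blast
    have "0 < x $ i \<and> x $ i < 2 ^ (j g i + 1)" for i
      using g(2) less_trans[of 0 "2 ^ j g i" "x $ i"] by (simp add: D_def mem_box_cart)
    then show "x \<in> ?E"
      using strong_maximal_test_functions[OF m, of x "j g" N] sum_j[OF g(1)] N by simp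
  qed
  have "ennreal (real (q + 1) ^ (CARD('n) - 1) * 2 ^ J) = (\<Sum>g\<in>G. emeasure lborel (D g))"
    using emD cG by (simp add: ennreal_mult ennreal_of_nat_eq_real_of_nat)
  also have "\<dots> = emeasure lborel (\<Union>g\<in>G. D g)"
    using fG by (intro sum_emeasure disj) (auto simp: D_def)
  also have "\<dots> \<le> emeasure lborel ?E"
    using sub openE by (intro emeasure_mono) auto
  finally show ?thesis using openE by simp
qed

text \<open>Since \<open>log N\<close> is comparable to \<open>q + 1\<close>, the
  \<open>m\<close>-th power of the estimate reads \<open>(q + 1) ^ (m * (n - 1)) \<le> M * (q + 1) ^
  ((m - 1) * (n - 1))\<close> after cancelling \<open>2 ^ (J * m)\<close>, with \<open>n\<close> the
  dimension. This bounds \<open>q\<close>, which is arbitrary.\<close>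

lemma not_distributional_estimate:
  assumes m: "m \<ge> 1" and n: "CARD('n) \<ge> 2" and k: "k \<le> m - 1" and C: "C > 0"
  shows "\<exists>N. \<not> distributional_estimate C m k 1 (test_functions N :: nat \<Rightarrow> real^'n \<Rightarrow> complex)"
proof (rule ccontr)
  let ?n = "CARD('n)"
  assume "\<not> ?thesis"
  then have est: "distributional_estimate C m k 1 (test_functions N :: nat \<Rightarrow> real^'n \<Rightarrow> complex)" for N by blast
  obtain D where D: "D \<ge> 1" and Phi_le: "\<And>u. u \<ge> 0 \<Longrightarrow> (Phi ?n ^^ k) u \<le> D * u * one_log u ^ (k * (?n - 1))"
    using Phi_iter_le by blast
  \<comment> \<open>Chosen so that \<open>one_log N \<le> c * (q + 1)\<close>; \<open>M\<close>
    collects all factors independent of \<open>q\<close>.\<close>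
  define c where "c = 2 + real m * real ?n"
  define M where "M = C ^ m * D * 2 * (2 ^ ?n) ^ m * c ^ ((m - 1) * (?n - 1))"
  obtain q :: nat where q: "M < real q" using reals_Archimedean2 by blast
  define J where "J = (?n - 1) * q"
  define N :: real where "N = 2 * (2 ^ (J + ?n)) ^ m"
  have N0: "N > 0" by (simp add: N_def)
  let ?Y = "(Phi ?n ^^ k) N" and ?q = "real (q + 1)"
  have Y: "?Y \<ge> 0" using Phi_iter_ge_self[of N, where n="?n" and k=k] N0 by simp
  have int: "(\<integral>\<^sup>+x. ennreal ((Phi ?n ^^ k) (cmod (test_functions N i x :: complex) / 1)) \<partial>(lebesgue :: (real^'n) measure))
      = ennreal (if i = 1 then ?Y else 1)" for i
    using test_functions_integral[where \<phi>="Phi ?n ^^ k" and N=N and R=UNIV and i=i and 'n='n] N0 Phi_iter_1[OF n, of k]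
    by (simp add: Phi_iter_0)
  have "ennreal (?q ^ (?n - 1) * 2 ^ J) \<le> emeasure lebesgue {x. strong_maximal m (test_functions N :: nat \<Rightarrow> real^'n \<Rightarrow> complex) x > 1}"
    by (rule strong_maximal_test_functions_large[OF m J_def N_def])
  also have "\<dots> \<le> ennreal C * ennroot m (\<Prod>i\<in>{1..m}. ennreal (if i = 1 then ?Y else 1))"
    using est[of N] unfolding distributional_estimate_def int by simp
  also have "(\<Prod>i\<in>{1..m}. ennreal (if i = 1 then ?Y else 1)) = ennreal ?Y"
    using Y m by (subst prod_ennreal) (auto simp: prod_test)
  also have "ennreal C * ennroot m (ennreal ?Y) = ennreal (C * root m ?Y)"
    using Y C m ennreal_mult[of C "root m ?Y"] real_root_ge_zero[of ?Y m] by (simp add: ennroot_def)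
  finally have "?q ^ (?n - 1) * 2 ^ J \<le> C * root m ?Y"
    using C Y m by (subst (asm) ennreal_le_iff) (auto intro!: mult_nonneg_nonneg real_root_ge_zero)
  then have "(?q ^ (?n - 1) * 2 ^ J) ^ m \<le> (C * root m ?Y) ^ m" by (intro power_mono) auto
  also have "\<dots> = C ^ m * ?Y" using Y m by (simp add: power_mult_distrib)
  also have "\<dots> \<le> C ^ m * (D * N * one_log N ^ (k * (?n - 1)))"
    using C N0 by (intro mult_left_mono Phi_le) auto
  also have "\<dots> \<le> C ^ m * (D * N * (c * ?q) ^ ((m - 1) * (?n - 1)))"
  proof -
    have "J + ?n \<le> ?n * (q + 1)" unfolding J_def by simp
    then have "real (J + ?n) \<le> real (?n * (q + 1))" by (rule of_nat_mono)
    then have J_le: "real (J + ?n) \<le> real ?n * ?q" by (simp only: of_nat_mult)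
    have "ln N = ln 2 + real m * (real (J + ?n) * ln 2)"
      unfolding N_def by (simp add: ln_mult ln_realpow)
    also have "\<dots> \<le> 1 + real m * (real (J + ?n) * 1)"
      using ln_le_minus_one[of "2::real"] by (intro add_mono mult_left_mono) auto
    also have "\<dots> \<le> 1 + real m * (real ?n * ?q)"
      using J_le by (intro add_mono mult_left_mono) auto
    finally have "ln N \<le> 1 + real m * (real ?n * ?q)" .
    then have "one_log N \<le> 2 + real m * real ?n * ?q"
      by (simp add: log_plus_def mult.assoc)
    also have "\<dots> \<le> c * ?q" by (simp add: c_def algebra_simps)
    finally have L: "one_log N \<le> c * ?q" .
    have "one_log N ^ (k * (?n - 1)) \<le> one_log N ^ ((m - 1) * (?n - 1))"
      using k log_plus_nonneg[of N] by (intro power_increasing mult_le_mono1) auto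
    also have "\<dots> \<le> (c * ?q) ^ ((m - 1) * (?n - 1))"
      using L log_plus_nonneg[of N] by (intro power_mono) auto
    finally show ?thesis using C D N0 by (intro mult_left_mono) auto
  qed
  also have "\<dots> = M * (2 ^ J) ^ m * ?q ^ ((m - 1) * (?n - 1))"
    unfolding M_def N_def by (simp add: power_add power_mult_distrib mult_ac)
  finally have "?q ^ ((?n - 1) * m) * (2 ^ J) ^ m \<le> M * ?q ^ ((m - 1) * (?n - 1)) * (2 ^ J) ^ m"
    by (simp only: power_mult_distrib power_mult[symmetric] mult_ac)
  then have "?q ^ ((?n - 1) * m) \<le> M * ?q ^ ((m - 1) * (?n - 1))"
    by (rule mult_right_le_imp_le) simp
  moreover have "(?n - 1) * m = (?n - 1) + (m - 1) * (?n - 1)"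
    using m by (cases m) (auto simp: mult.commute)
  ultimately have "?q ^ (?n - 1) * ?q ^ ((m - 1) * (?n - 1)) \<le> M * ?q ^ ((m - 1) * (?n - 1))"
    by (simp only: power_add)
  then have "?q ^ (?n - 1) \<le> M" by (rule mult_right_le_imp_le) simp
  \<comment> \<open>In dimension at least 2 a positive power of \<open>q + 1\<close> remains, which
    exceeds \<open>M\<close> by the choice of \<open>q\<close>.\<close>
  moreover have "?q ^ 1 \<le> ?q ^ (?n - 1)" using n by (intro power_increasing) auto
  ultimately show False using q by simp
qed

text \<open>Sharpness is claimed from dimension 2 on: in dimension 1,
  \<open>Phi 1 t = 2 * t\<close>, so all iterates agree up to constant factors.\<close>

theorem theorem3p1:
  fixes m :: nat
  assumes "m \<ge> 1"
  shows "(\<exists>C>0. \<forall>s>0. \<forall>f :: nat \<Rightarrow> real^'n \<Rightarrow> complex.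
            (\<forall>i\<in>{1..m}. locally_integrable (f i)) \<longrightarrow> distributional_estimate C m m s f) \<and>
         (CARD('n) \<ge> 2 \<longrightarrow> (\<forall>k \<le> m - 1.
            \<not> (\<exists>C>0. \<forall>s>0. \<forall>f :: nat \<Rightarrow> real^'n \<Rightarrow> complex.
            (\<forall>i\<in>{1..m}. locally_integrable (f i)) \<longrightarrow> distributional_estimate C m k s f)))"
proof (intro conjI impI allI)
  show "\<exists>C>0. \<forall>s>0. \<forall>f :: nat \<Rightarrow> real^'n \<Rightarrow> complex.
      (\<forall>i\<in>{1..m}. locally_integrable (f i)) \<longrightarrow> distributional_estimate C m m s f"
    by (rule distributional_estimate_m[OF assms])
next
  fix k assume "CARD('n) \<ge> 2" "k \<le> m - 1"
  then show "\<not> (\<exists>C>0. \<forall>s>0. \<forall>f :: nat \<Rightarrow> real^'n \<Rightarrow> complex.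
      (\<forall>i\<in>{1..m}. locally_integrable (f i)) \<longrightarrow> distributional_estimate C m k s f)"
    using not_distributional_estimate[OF assms, where 'n='n] locally_integrable_test_functions
    by (meson zero_less_one)
qed

end
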